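(* Let $p_1,p_2\in [1,\infty)$ and let $\delta_1,\delta_2 \in(0,1)$. Then there exist dimensional constants $c_{n_1}, c_{n_2}>0$ (depending only on $n_1$ and $n_2$ respectively) such that for every locally integrable function $f$ on $\mathbb{R}^{n_1}\times\mathbb{R}^{n_2}$ and every rectangle $R=I_1\times I_2 \in \mathfrak{R}$, $$\frac1{|R|}\int_{R} |f - f_{R}|\,dx\leq c_{n_1} (1-\delta_1)^{\frac{1}{p_1}}\, a_1(R) + c_{n_2} \, (1-\delta_2)^{\frac{1}{p_2}}\,a_2(R),$$ where $$a_1(R)= \ell(I_1)^{\delta_1}\left(\frac1{|R|}\int_{I_2}\int_{I_1}\int_{ I_1} \frac{|f(x_1,x_2)- f(y_1,x_2)|^{p_1}}{|x_1-y_1|^{n_1+p_1\delta_1}}\, dy_1\, dx_1\, dx_2\right)^{\frac1{p_1}}$$ and $$a_2(R)= \ell(I_2)^{\delta_2}\left(\frac1{|R|}\int_{I_1}\int_{I_2} \int_{I_2} \frac{|f(y_1, x_2) - f(y_1, y_2) |^{p_2}}{|x_2-y_2|^{n_2+p_2\delta_2}}\, dx_2\, dy_2\, dy_1\right)^{\frac{1}{p_2}}.$$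
   Context: $\mathfrak{R}$ is the family of rectangles $R=I_1\times I_2\subset\mathbb{R}^{n_1}\times\mathbb{R}^{n_2}$ where $I_1\subset\mathbb{R}^{n_1}$ and $I_2\subset\mathbb{R}^{n_2}$ are cubes with sides parallel to the coordinate axes; $\ell(I)$ is the sidelength of the cube $I$. Points are written $(x_1,x_2)$ with $x_i\in\mathbb{R}^{n_i}$, and $f_R=\frac1{|R|}\int_Rf\,dx$. *)

theory Defs
  imports "HOL-Analysis.Analysis"
begin

text \<open>
  The constants in the theorem depend on one dimension each, so the dimensions have to be
  quantified inside the statement. For this reason $\mathbb{R}^n$ is the carrier
  \<open>{..<n} \<rightarrow>\<^sub>E UNIV\<close> of extensional functions \<open>nat \<Rightarrow> real\<close>, its Euclidean norm is
  \<^const>\<open>L2_set\<close> over \<open>{..<n}\<close>, and its measure is the product of \<open>n\<close> copies of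
  \<^const>\<open>lborel\<close>. Completions are taken so that all Lebesgue measurable functions are covered.
\<close>

definition leb :: "nat \<Rightarrow> (nat \<Rightarrow> real) measure" where
  "leb n = completion (PiM {..<n} (\<lambda>_. lborel))"

definition leb2 :: "nat \<Rightarrow> nat \<Rightarrow> ((nat \<Rightarrow> real) \<times> (nat \<Rightarrow> real)) measure" where
  "leb2 n1 n2 = completion (PiM {..<n1} (\<lambda>_. lborel) \<Otimes>\<^sub>M PiM {..<n2} (\<lambda>_. lborel))"

definition is_cube :: "nat \<Rightarrow> real \<Rightarrow> (nat \<Rightarrow> real) set \<Rightarrow> bool" where
  "is_cube n l I \<longleftrightarrow> 0 < l \<and> (\<exists>a. I = PiE {..<n} (\<lambda>i. {a i .. a i + l}))"

text \<open>
  On the carriers, the type class topology of \<open>nat \<Rightarrow> real\<close> (pointwise convergence) is the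
  Euclidean one: extensional functions are constantly \<^const>\<open>undefined\<close> outside \<open>{..<n}\<close>.
\<close>

definition locally_integrable ::
    "nat \<Rightarrow> nat \<Rightarrow> ((nat \<Rightarrow> real) \<times> (nat \<Rightarrow> real) \<Rightarrow> real) \<Rightarrow> bool" where
  "locally_integrable n1 n2 f \<longleftrightarrow>
     (\<forall>K. compact K \<and> K \<subseteq> space (leb2 n1 n2) \<longrightarrow> set_integrable (leb2 n1 n2) K f)"

definition mean ::
    "nat \<Rightarrow> nat \<Rightarrow> ((nat \<Rightarrow> real) \<times> (nat \<Rightarrow> real)) set
      \<Rightarrow> ((nat \<Rightarrow> real) \<times> (nat \<Rightarrow> real) \<Rightarrow> real) \<Rightarrow> real" where
  "mean n1 n2 R f = (1 / measure (leb2 n1 n2) R) * (LINT x:R|leb2 n1 n2. f x)"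

text \<open>
  Only used for exponents \<open>r > 0\<close>, hence the value at \<open>\<infinity>\<close>.
\<close>

definition ennreal_powr :: "ennreal \<Rightarrow> real \<Rightarrow> ennreal" where
  "ennreal_powr x r = (if x = \<infinity> then \<infinity> else ennreal (enn2real x powr r))"

text \<open>
  The fractional seminorms of a locally integrable function may be infinite, so they are
  \<^typ>\<open>ennreal\<close>-valued. On the diagonal the integrands below are \<open>0 / 0 = 0\<close>, which only
  concerns a null set when the dimensions are positive.
\<close>

definition a1 ::
    "nat \<Rightarrow> nat \<Rightarrow> real \<Rightarrow> real \<Rightarrow> ((nat \<Rightarrow> real) \<times> (nat \<Rightarrow> real) \<Rightarrow> real)
      \<Rightarrow> real \<Rightarrow> (nat \<Rightarrow> real) set \<Rightarrow> (nat \<Rightarrow> real) set \<Rightarrow> ennreal" where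
  "a1 n1 n2 p \<delta> f l1 I1 I2 =
     ennreal (l1 powr \<delta>) *
     ennreal_powr
       ((\<integral>\<^sup>+x2\<in>I2. (\<integral>\<^sup>+x1\<in>I1. (\<integral>\<^sup>+y1\<in>I1.
            ennreal (\<bar>f (x1, x2) - f (y1, x2)\<bar> powr p
                     / L2_set (\<lambda>i. x1 i - y1 i) {..<n1} powr (real n1 + p * \<delta>))
          \<partial>leb n1) \<partial>leb n1) \<partial>leb n2)
        / emeasure (leb2 n1 n2) (I1 \<times> I2))
       (1 / p)"

definition a2 ::
    "nat \<Rightarrow> nat \<Rightarrow> real \<Rightarrow> real \<Rightarrow> ((nat \<Rightarrow> real) \<times> (nat \<Rightarrow> real) \<Rightarrow> real)
      \<Rightarrow> real \<Rightarrow> (nat \<Rightarrow> real) set \<Rightarrow> (nat \<Rightarrow> real) set \<Rightarrow> ennreal" where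
  "a2 n1 n2 p \<delta> f l2 I1 I2 =
     ennreal (l2 powr \<delta>) *
     ennreal_powr
       ((\<integral>\<^sup>+y1\<in>I1. (\<integral>\<^sup>+y2\<in>I2. (\<integral>\<^sup>+x2\<in>I2.
            ennreal (\<bar>f (y1, x2) - f (y1, y2)\<bar> powr p
                     / L2_set (\<lambda>i. x2 i - y2 i) {..<n2} powr (real n2 + p * \<delta>))
          \<partial>leb n2) \<partial>leb n2) \<partial>leb n1)
        / emeasure (leb2 n1 n2) (I1 \<times> I2))
       (1 / p)"

end

theory Submission
  imports Defs
begin

text \<open>
  Let \<open>F t\<close> be the integral of \<open>\<bar>u x - u y\<bar> powr p\<close> over the pairs of points of a cube at distance
  at most \<open>t\<close>. Splitting at the midpoint of \<open>x\<close> and \<open>y\<close> gives \<open>F t \<le> 2 powr (n + p) * F (t / 2)\<close>, so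
  every dyadic scale \<open>t / 2 ^ k\<close> carries a definite share of \<open>F t\<close>. Summing these shares against the
  weights that make up the kernel \<open>\<bar>x - y\<bar> powr - (n + p * \<delta>)\<close> produces the geometric series with
  ratio \<open>2 powr (- p * (1 - \<delta>))\<close>, whose sum is at least \<open>1 / (p * (1 - \<delta>))\<close>; this is the gain
  \<open>1 - \<delta>\<close>. On a rectangle, \<open>f (x1, x2) - f (y1, y2)\<close> is split at \<open>f (y1, x2)\<close>, and the one-variable
  bound is integrated over the other variable before Jensen's inequality is applied once.
\<close>

section \<open>Borel product Lebesgue measure and affine substitution\<close>

text \<open>The measure before completion, for which Tonelli's theorem and the measurability of
  sections are directly available. The completions \<open>leb\<close> and \<open>leb2\<close>
  reappear only in \<open>theorem2p18\<close>.\<close>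

abbreviation leb_borel :: "nat \<Rightarrow> (nat \<Rightarrow> real) measure" where
  "leb_borel n \<equiv> PiM {..<n} (\<lambda>_. lborel)"

lemma product_sigma_finite_lborel: "product_sigma_finite (\<lambda>_::nat. lborel :: real measure)"
  by standard

lemma sigma_finite_leb_borel: "sigma_finite_measure (leb_borel n)"
  by (intro product_sigma_finite.sigma_finite product_sigma_finite_lborel) simp

lemma pair_sigma_finite_leb_borel: "pair_sigma_finite (leb_borel m) (leb_borel n)"
  by (intro pair_sigma_finite.intro sigma_finite_leb_borel)

text \<open>The image of the product measure under \<open>y\<close> to \<open>t + c * y\<close>,
  rescaled, agrees with the product measure on boxes, coordinate by coordinate; uniqueness of
  product measures then gives equality. The midpoint substitution is the case
  \<open>c = 1/2\<close>.\<close>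

lemma nn_integral_PiM_lborel_affine:
  fixes c :: real and t :: "nat \<Rightarrow> real"
  assumes I: "finite I" and c: "c \<noteq> 0" and f: "f \<in> borel_measurable (PiM I (\<lambda>_. lborel))"
  shows "(\<integral>\<^sup>+y. f y \<partial>PiM I (\<lambda>_. lborel))
    = ennreal (\<bar>c\<bar> ^ card I) * (\<integral>\<^sup>+y. f (\<lambda>i\<in>I. t i + c * y i) \<partial>PiM I (\<lambda>_. lborel))"
proof -
  interpret product_sigma_finite "\<lambda>_::nat. lborel :: real measure"
    by (rule product_sigma_finite_lborel)
  let ?P = "PiM I (\<lambda>_. lborel :: real measure)"
  let ?T = "\<lambda>y. \<lambda>i\<in>I. t i + c * y i"
  have T[measurable]: "?T \<in> ?P \<rightarrow>\<^sub>M ?P"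
    by (rule measurable_restrict) measurable
  have "scale_measure (ennreal (\<bar>c\<bar> ^ card I)) (distr ?P ?P ?T) = ?P"
  proof (rule PiM_eqI[OF I])
    fix A :: "nat \<Rightarrow> real set" assume A: "\<And>i. i \<in> I \<Longrightarrow> A i \<in> sets lborel"
    have *: "?T -` Pi\<^sub>E I A \<inter> space ?P = Pi\<^sub>E I (\<lambda>i. (\<lambda>y. t i + c * y) -` A i)"
      by (auto simp: space_PiM PiE_def Pi_def extensional_def)
    have m: "(\<lambda>y. t i + c * y) -` A i \<in> sets lborel" if "i \<in> I" for i
      using measurable_sets[of "\<lambda>y. t i + c * y" lborel lborel "A i"] A[OF that] by simp
    have e: "ennreal \<bar>c\<bar> * emeasure lborel ((\<lambda>y. t i + c * y) -` A i) = emeasure lborel (A i)"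
      if i: "i \<in> I" for i
    proof -
      have [measurable]: "A i \<in> sets borel" using A[OF i] by simp
      have "emeasure lborel (A i) = (\<integral>\<^sup>+x. indicator (A i) x \<partial>lborel)"
        by simp
      also have "\<dots> = ennreal \<bar>c\<bar> * (\<integral>\<^sup>+x. indicator (A i) (t i + c * x) \<partial>lborel)"
        by (rule nn_integral_real_affine[OF _ c]) measurable
      also have "(\<integral>\<^sup>+x. indicator (A i) (t i + c * x) \<partial>lborel)
          = (\<integral>\<^sup>+x. indicator ((\<lambda>y. t i + c * y) -` A i) x \<partial>lborel)"
        by (intro nn_integral_cong) (auto split: split_indicator)
      also have "\<dots> = emeasure lborel ((\<lambda>y. t i + c * y) -` A i)"
        using m[OF i] by (rule nn_integral_indicator)
      finally show ?thesis by simp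
    qed
    have "emeasure (scale_measure (ennreal (\<bar>c\<bar> ^ card I)) (distr ?P ?P ?T)) (Pi\<^sub>E I A)
        = ennreal (\<bar>c\<bar> ^ card I) * emeasure ?P (?T -` Pi\<^sub>E I A \<inter> space ?P)"
      using I A by (subst emeasure_scale_measure, subst emeasure_distr) (auto intro!: sets_PiM_I_finite)
    also have "\<dots> = (\<Prod>i\<in>I. ennreal \<bar>c\<bar> * emeasure lborel ((\<lambda>y. t i + c * y) -` A i))"
      unfolding * using I m by (subst emeasure_PiM) (auto simp: prod.distrib ennreal_power)
    also have "\<dots> = (\<Prod>i\<in>I. emeasure lborel (A i))"
      by (intro prod.cong refl e)
    finally show "emeasure (scale_measure (ennreal (\<bar>c\<bar> ^ card I)) (distr ?P ?P ?T)) (Pi\<^sub>E I A)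
      = (\<Prod>i\<in>I. emeasure lborel (A i))" .
  qed simp
  then have "(\<integral>\<^sup>+y. f y \<partial>?P) = (\<integral>\<^sup>+y. f y \<partial>scale_measure (ennreal (\<bar>c\<bar> ^ card I)) (distr ?P ?P ?T))"
    by simp
  also have "\<dots> = ennreal (\<bar>c\<bar> ^ card I) * (\<integral>\<^sup>+y. f (?T y) \<partial>?P)"
    using f by (simp add: nn_integral_scale_measure nn_integral_distr)
  finally show ?thesis .
qed

section \<open>Convexity of powers, Jensen's inequality and dyadic sums\<close>

text \<open>Convexity of \<open>u powr p\<close> at the midpoint of \<open>a\<close> and
  \<open>b\<close>. It is applied to positive numbers only, so the cases with a zero are settled by
  hand.\<close>

lemma powr_sum_le:
  fixes a b p :: real
  assumes "0 \<le> a" "0 \<le> b" "1 \<le> p"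
  shows "(a + b) powr p \<le> 2 powr (p - 1) * (a powr p + b powr p)"
proof -
  have z: "b powr p \<le> 2 powr (p - 1) * b powr p" for b :: real
    using assms(3) by (simp add: mult_le_cancel_right1 ge_one_powr_ge_zero)
  show ?thesis
  proof (cases "a = 0 \<or> b = 0")
    case True
    then show ?thesis using z[of a] z[of b] assms by auto
  next
    case False
    with assms have ab: "0 < a" "0 < b" by auto
    have "((1 - 1/2) *\<^sub>R a + (1/2) *\<^sub>R b) powr p \<le> (1 - 1/2) * a powr p + 1/2 * b powr p"
      using ab by (intro convex_onD[OF powr_convex[OF assms(3)]]) auto
    then have "((a + b) / 2) powr p \<le> (a powr p + b powr p) / 2"
      by (simp add: field_simps)
    then show ?thesis using ab
      by (simp add: powr_divide powr_diff field_simps)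
  qed
qed

text \<open>The tangent to \<open>u powr p\<close> at 1 lies below the graph; solved for
  \<open>u\<close>, this is Young's inequality with second factor 1.\<close>

lemma powr_tangent_le:
  fixes u p :: real
  assumes u: "0 \<le> u" and p: "1 \<le> p"
  shows "u \<le> u powr p / p + (1 - 1 / p)"
proof (cases "p = 1 \<or> u = 0")
  case True
  then show ?thesis using assms by (auto simp: field_simps)
next
  case False
  then have "(u powr p) powr (1/p) * 1 powr (1 - 1/p) \<le> (1/p) * u powr p + (1 - 1/p) * 1"
    using False assms by (intro Youngs_inequality_0) (auto simp: field_simps)
  then show ?thesis using assms by (simp add: powr_powr)
qed

text \<open>Stated with an upper bound \<open>A\<close> in place of the \<open>p\<close>-mean itself, which may vanish and could then
  not be divided by.\<close>
lemma nn_integral_le_of_powr_mean_le: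
  fixes h :: "'a \<Rightarrow> real"
  assumes h[measurable]: "h \<in> borel_measurable M" and h0: "\<And>x. 0 \<le> h x"
    and p: "1 \<le> p" and A: "0 < A"
    and le: "(\<integral>\<^sup>+x. ennreal (h x powr p) \<partial>M) \<le> ennreal (A powr p) * emeasure M (space M)"
  shows "(\<integral>\<^sup>+x. ennreal (h x) \<partial>M) \<le> ennreal A * emeasure M (space M)"
proof -
  \<comment> \<open>Jensen's inequality made pointwise: the tangent bound at \<open>h x / A\<close>,
    multiplied by \<open>A\<close>. After integration the two coefficients add up to exactly
    \<open>A\<close>.\<close>
  have "h x \<le> A powr (1 - p) / p * h x powr p + A * (1 - 1 / p)" for x
  proof -
    have "h x / A \<le> (h x / A) powr p / p + (1 - 1/p)"
      using h0 A p by (intro powr_tangent_le) auto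
    then have "h x \<le> A * ((h x / A) powr p / p + (1 - 1/p))"
      using A by (simp add: field_simps)
    also have "\<dots> = A powr (1 - p) / p * h x powr p + A * (1 - 1 / p)"
      using A h0[of x] by (simp add: powr_divide powr_diff field_simps)
    finally show ?thesis .
  qed
  then have "(\<integral>\<^sup>+x. ennreal (h x) \<partial>M)
    \<le> (\<integral>\<^sup>+x. ennreal (A powr (1 - p) / p) * ennreal (h x powr p) + ennreal (A * (1 - 1 / p)) \<partial>M)"
    using p A by (intro nn_integral_mono)
      (simp add: ennreal_mult[symmetric] ennreal_plus[symmetric] ennreal_leI del: ennreal_plus)
  also have "\<dots> = ennreal (A powr (1 - p) / p) * (\<integral>\<^sup>+x. ennreal (h x powr p) \<partial>M)
      + ennreal (A * (1 - 1 / p)) * emeasure M (space M)"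
    by (subst nn_integral_add) (auto simp: nn_integral_cmult)
  also have "\<dots> \<le> ennreal (A powr (1 - p) / p) * (ennreal (A powr p) * emeasure M (space M))
      + ennreal (A * (1 - 1 / p)) * emeasure M (space M)"
    by (intro add_right_mono mult_left_mono le) simp
  also have "\<dots> = (ennreal (A powr (1 - p) / p) * ennreal (A powr p) + ennreal (A * (1 - 1 / p))) * emeasure M (space M)"
    by (simp add: algebra_simps)
  also have "ennreal (A powr (1 - p) / p) * ennreal (A powr p) + ennreal (A * (1 - 1 / p))
      = ennreal (A powr (1 - p) / p * A powr p + A * (1 - 1/p))"
    using p A by (simp add: ennreal_mult[symmetric] ennreal_plus[symmetric] del: ennreal_plus)
  also have "A powr (1 - p) / p * A powr p + A * (1 - 1/p) = A"
    using p A by (simp add: powr_diff field_simps)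
  finally show ?thesis .
qed

text \<open>The surviving terms form a geometric progression with ratio \<open>2 powr s\<close>,
  which is at least 2, so they sum to at most twice the last one. With \<open>r = T / d\<close> this
  bounds the total weight of the scales \<open>T / 2 ^ k\<close> that see a pair at distance
  \<open>d\<close>.\<close>

lemma sum_dyadic_powr_le:
  fixes r s :: real
  assumes s: "1 \<le> s" and r: "0 < r"
  shows "(\<Sum>k<N. if 2 ^ k \<le> r then (2 ^ k) powr s else 0) \<le> 2 * r powr s"
proof (induction N)
  case 0
  show ?case by simp
next
  case (Suc N)
  show ?case
  proof (cases "2 ^ N \<le> r")
    case False
    with Suc show ?thesis by simp
  next
    case True
    have g: "(\<Sum>k<Suc m. (2 ^ k) powr s) \<le> 2 * (2 ^ m) powr s" for m :: nat
    proof (induction m)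
      case (Suc m)
      have "2 * (2 ^ m) powr s \<le> 2 powr s * (2 ^ m) powr s"
        using powr_mono[of 1 s 2] s by (intro mult_right_mono) auto
      also have "\<dots> = (2 ^ Suc m) powr s" by (simp add: powr_mult)
      finally show ?case using Suc by simp
    qed simp
    have "(\<Sum>k<Suc N. if 2 ^ k \<le> r then (2 ^ k) powr s else 0) \<le> (\<Sum>k<Suc N. (2 ^ k) powr s)"
      by (intro sum_mono) auto
    also have "\<dots> \<le> 2 * (2 ^ N) powr s" by (rule g)
    also have "\<dots> \<le> 2 * r powr s"
      using True s by (intro mult_left_mono powr_mono2) auto
    finally show ?thesis .
  qed
qed

section \<open>The energy of pairs close to the diagonal and its halving\<close>

lemma L2_set_measurable [measurable]:
  "(\<lambda>z. L2_set (\<lambda>i. fst z i - snd z i) {..<n}) \<in> borel_measurable (leb_borel n \<Otimes>\<^sub>M leb_borel n)"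
  unfolding L2_set_def by measurable

abbreviation euclidean_dist :: "nat \<Rightarrow> (nat \<Rightarrow> real) \<Rightarrow> (nat \<Rightarrow> real) \<Rightarrow> real" where
  "euclidean_dist n x y \<equiv> L2_set (\<lambda>i. x i - y i) {..<n}"

lemma euclidean_dist_commute: "euclidean_dist n x y = euclidean_dist n y x"
  unfolding L2_set_def by (simp add: power2_commute)

text \<open>The function \<open>F t\<close> described at the start. The set enters through
  indicators, so that the integrals run over the whole space and an affine substitution applies to
  them.\<close>

definition near_energy ::
    "nat \<Rightarrow> real \<Rightarrow> ((nat \<Rightarrow> real) \<Rightarrow> real) \<Rightarrow> (nat \<Rightarrow> real) set \<Rightarrow> real \<Rightarrow> ennreal" where
  "near_energy n p u Q t = (\<integral>\<^sup>+x. (\<integral>\<^sup>+y.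
     indicator Q x * indicator Q y * indicator {..t} (euclidean_dist n x y)
       * ennreal (\<bar>u x - u y\<bar> powr p) \<partial>leb_borel n) \<partial>leb_borel n)"

lemma box_in_sets_leb_borel [measurable]:
  "PiE {..<n} (\<lambda>i. {a i .. b i :: real}) \<in> sets (leb_borel n)"
  by (rule sets_PiM_I_finite) auto

text \<open>Split \<open>u x - u y\<close> at the midpoint of \<open>x\<close> and \<open>y\<close>, which stays in the box, and substitute the
  midpoint for one of the endpoints.\<close>
lemma near_energy_halving:
  fixes u :: "(nat \<Rightarrow> real) \<Rightarrow> real"
  assumes u[measurable]: "u \<in> borel_measurable (leb_borel n)" and p: "1 \<le> p"
    and Q: "Q = PiE {..<n} (\<lambda>i. {a i .. b i})"
  shows "near_energy n p u Q t \<le> ennreal (2 powr (real n + p)) * near_energy n p u Q (t / 2)"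
proof -
  let ?P = "leb_borel n"
  define W where "W t x y = (indicator Q x * indicator Q y * indicator {..t} (euclidean_dist n x y)
       * ennreal (\<bar>u x - u y\<bar> powr p) :: ennreal)" for t x y
  define m where "m x y = (\<lambda>i\<in>{..<n}. x i / 2 + 1 / 2 * y i)" for x y :: "nat \<Rightarrow> real"
  have Qm[measurable]: "Q \<in> sets ?P" unfolding Q by measurable
  have W1: "(\<lambda>z. W t (fst z) (snd z)) \<in> borel_measurable (?P \<Otimes>\<^sub>M ?P)" for t
    unfolding W_def by measurable
  have Wm: "(\<lambda>z. W t (f z) (g z)) \<in> borel_measurable N"
    if "f \<in> N \<rightarrow>\<^sub>M ?P" "g \<in> N \<rightarrow>\<^sub>M ?P" for t f g and N :: "'z measure"
    using measurable_compose[OF measurable_Pair[OF that] W1, of t] by simp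
  have mm[measurable]: "(\<lambda>z. m (fst z) (snd z)) \<in> ?P \<Otimes>\<^sub>M ?P \<rightarrow>\<^sub>M ?P"
    unfolding m_def by (rule measurable_restrict) measurable
  have mm2: "m x \<in> ?P \<rightarrow>\<^sub>M ?P" for x
    unfolding m_def by (rule measurable_restrict) measurable
  have mm1: "(\<lambda>x. m x y) \<in> ?P \<rightarrow>\<^sub>M ?P" for y
    unfolding m_def by (rule measurable_restrict) measurable
  interpret sigma_finite_measure ?P by (rule sigma_finite_leb_borel)
  have comm: "m x y = m y x" for x y
    unfolding m_def by (intro restrict_ext) simp
  \<comment> \<open>For fixed \<open>x\<close>, moving \<open>y\<close> to the midpoint contracts by
    1/2, which costs the Jacobian factor \<open>2 ^ n\<close>.\<close>
  have sub: "(\<integral>\<^sup>+y. W t x (m x y) \<partial>?P) = ennreal (2 ^ n) * (\<integral>\<^sup>+y. W t x y \<partial>?P)"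
    if x: "x \<in> space ?P" for x t
  proof -
    have "(\<integral>\<^sup>+y. W t x y \<partial>?P) = ennreal (\<bar>1/2\<bar> ^ card {..<n}) * (\<integral>\<^sup>+y. W t x (m x y) \<partial>?P)"
      unfolding m_def using x by (intro nn_integral_PiM_lborel_affine Wm) auto
    then have "ennreal (2 ^ n) * (\<integral>\<^sup>+y. W t x y \<partial>?P)
        = (ennreal (2 ^ n) * ennreal ((1/2) ^ n)) * (\<integral>\<^sup>+y. W t x (m x y) \<partial>?P)"
      by (simp add: mult.assoc)
    also have "ennreal (2 ^ n) * ennreal ((1/2) ^ n) = 1"
      by (simp add: ennreal_mult[symmetric] power_mult_distrib[symmetric])
    finally show ?thesis by simp
  qed
  have dist_m: "euclidean_dist n x (m x y) = euclidean_dist n x y / 2" for x y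
  proof -
    have "euclidean_dist n x (m x y) = L2_set (\<lambda>i. 1 / 2 * (x i - y i)) {..<n}"
      unfolding m_def by (intro L2_set_cong) (auto simp: field_simps)
    also have "\<dots> = 1 / 2 * euclidean_dist n x y"
      by (rule L2_set_right_distrib[symmetric]) simp
    finally show ?thesis by simp
  qed
  have mQ: "m x y \<in> Q" if "x \<in> Q" "y \<in> Q" for x y
  proof -
    have "x i / 2 + 1 / 2 * y i \<in> {a i .. b i}" if "i < n" for i
    proof -
      have "x i \<in> {a i .. b i}" "y i \<in> {a i .. b i}"
        using \<open>x \<in> Q\<close> \<open>y \<in> Q\<close> that unfolding Q by (auto simp: PiE_iff)
      then show ?thesis by auto
    qed
    then show ?thesis unfolding m_def Q by (auto simp: PiE_iff)
  qed
  \<comment> \<open>The midpoint is written \<open>m y x\<close> in the second term, so that this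
    term is the first one with \<open>x\<close> and \<open>y\<close> exchanged and integrates to the
    same value.\<close>
  have pt: "W t x y \<le> ennreal (2 powr (p - 1)) * (W (t / 2) x (m x y) + W (t / 2) y (m y x))" for x y
  proof (cases "x \<in> Q \<and> y \<in> Q \<and> euclidean_dist n x y \<le> t")
    case False
    then show ?thesis unfolding W_def by auto
  next
    case True
    have d: "euclidean_dist n x (m x y) \<le> t / 2" "euclidean_dist n y (m y x) \<le> t / 2"
      using True by (simp_all add: dist_m euclidean_dist_commute[of y x])
    have q: "m x y \<in> Q" "m y x \<in> Q" using True mQ by auto
    have "\<bar>u x - u y\<bar> powr p \<le> (\<bar>u x - u (m x y)\<bar> + \<bar>u y - u (m x y)\<bar>) powr p"
      using p by (intro powr_mono2) auto
    also have "\<dots> \<le> 2 powr (p - 1) * (\<bar>u x - u (m x y)\<bar> powr p + \<bar>u y - u (m x y)\<bar> powr p)"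
      using p by (intro powr_sum_le) auto
    finally have "\<bar>u x - u y\<bar> powr p
      \<le> 2 powr (p - 1) * (\<bar>u x - u (m x y)\<bar> powr p + \<bar>u y - u (m y x)\<bar> powr p)"
      by (simp add: comm[of y x])
    then show ?thesis
      using True d q unfolding W_def
      by (simp add: ennreal_mult[symmetric] ennreal_plus[symmetric] ennreal_leI del: ennreal_plus)
  qed
  have A: "(\<integral>\<^sup>+x. (\<integral>\<^sup>+y. W t x (m x y) \<partial>?P) \<partial>?P) = ennreal (2 ^ n) * near_energy n p u Q t" for t
  proof -
    have "(\<integral>\<^sup>+x. (\<integral>\<^sup>+y. W t x (m x y) \<partial>?P) \<partial>?P)
      = (\<integral>\<^sup>+x. ennreal (2 ^ n) * (\<integral>\<^sup>+y. W t x y \<partial>?P) \<partial>?P)"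
      by (intro nn_integral_cong sub)
    also have "\<dots> = ennreal (2 ^ n) * (\<integral>\<^sup>+x. (\<integral>\<^sup>+y. W t x y \<partial>?P) \<partial>?P)"
      by (intro nn_integral_cmult borel_measurable_nn_integral) (simp add: case_prod_beta' Wm)
    finally show ?thesis unfolding near_energy_def W_def .
  qed
  \<comment> \<open>This is \<open>A\<close> with its two variables renamed, so exchanging the order
    of integration suffices.\<close>
  have B: "(\<integral>\<^sup>+x. (\<integral>\<^sup>+y. W t y (m y x) \<partial>?P) \<partial>?P) = ennreal (2 ^ n) * near_energy n p u Q t" for t
  proof -
    have "(\<lambda>z. W t (fst z) (m (fst z) (snd z))) \<in> borel_measurable (?P \<Otimes>\<^sub>M ?P)"
      by (rule Wm[OF measurable_fst mm])
    then show ?thesis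
      unfolding A[symmetric]
      by (intro pair_sigma_finite.Fubini' pair_sigma_finite_leb_borel) (simp add: case_prod_beta')
  qed
  have "near_energy n p u Q t = (\<integral>\<^sup>+x. (\<integral>\<^sup>+y. W t x y \<partial>?P) \<partial>?P)"
    unfolding near_energy_def W_def ..
  also have "\<dots> \<le> (\<integral>\<^sup>+x. (\<integral>\<^sup>+y. ennreal (2 powr (p - 1)) * (W (t / 2) x (m x y) + W (t / 2) y (m y x)) \<partial>?P) \<partial>?P)"
    by (intro nn_integral_mono pt)
  also have "\<dots> = (\<integral>\<^sup>+x. ennreal (2 powr (p - 1)) *
      ((\<integral>\<^sup>+y. W (t / 2) x (m x y) \<partial>?P) + (\<integral>\<^sup>+y. W (t / 2) y (m y x) \<partial>?P)) \<partial>?P)"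
  proof (intro nn_integral_cong)
    fix x assume x: "x \<in> space ?P"
    have 1: "(\<lambda>y. W (t / 2) x (m x y)) \<in> borel_measurable ?P"
      using x by (intro Wm mm2) simp
    have 2: "(\<lambda>y. W (t / 2) y (m y x)) \<in> borel_measurable ?P"
      by (intro Wm mm1 measurable_ident_sets refl)
    show "(\<integral>\<^sup>+y. ennreal (2 powr (p - 1)) * (W (t / 2) x (m x y) + W (t / 2) y (m y x)) \<partial>?P)
      = ennreal (2 powr (p - 1)) * ((\<integral>\<^sup>+y. W (t / 2) x (m x y) \<partial>?P) + (\<integral>\<^sup>+y. W (t / 2) y (m y x) \<partial>?P))"
      using 1 2 by (simp add: nn_integral_cmult nn_integral_add)
  qed
  also have "\<dots> = ennreal (2 powr (p - 1)) *
      ((\<integral>\<^sup>+x. (\<integral>\<^sup>+y. W (t / 2) x (m x y) \<partial>?P) \<partial>?P) + (\<integral>\<^sup>+x. (\<integral>\<^sup>+y. W (t / 2) y (m y x) \<partial>?P) \<partial>?P))"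
  proof -
    have 1: "(\<lambda>x. \<integral>\<^sup>+y. W (t / 2) x (m x y) \<partial>?P) \<in> borel_measurable ?P"
      by (intro borel_measurable_nn_integral) (simp add: case_prod_beta' Wm)
    have 2: "(\<lambda>x. \<integral>\<^sup>+y. W (t / 2) y (m y x) \<partial>?P) \<in> borel_measurable ?P"
      using Wm[of snd "?P \<Otimes>\<^sub>M ?P" "\<lambda>z. m (fst z) (snd z)"]
      by (intro borel_measurable_nn_integral) (simp add: case_prod_beta' comm[of "snd _"])
    show ?thesis using 1 2 by (simp add: nn_integral_cmult nn_integral_add)
  qed
  also have "\<dots> = ennreal (2 powr (p - 1)) * ennreal (2 * 2 ^ n) * near_energy n p u Q (t / 2)"
    unfolding A B by (simp add: ennreal_mult mult.assoc flip: mult_2)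
  \<comment> \<open>Convexity gives \<open>2 powr (p - 1)\<close>, the two half-segments give 2, the
    substitution gives \<open>2 ^ n\<close>.\<close>
  also have "ennreal (2 powr (p - 1)) * ennreal (2 * 2 ^ n) = ennreal (2 powr (real n + p))"
    by (subst ennreal_mult[symmetric]) (auto simp: powr_diff powr_add powr_realpow)
  finally show ?thesis .
qed

lemma near_energy_halving_iterated:
  assumes "u \<in> borel_measurable (leb_borel n)" "1 \<le> p" "Q = PiE {..<n} (\<lambda>i. {a i .. b i})"
  shows "near_energy n p u Q t
    \<le> ennreal ((2 powr (real n + p)) ^ k) * near_energy n p u Q (t / 2 ^ k)"
proof (induction k)
  case (Suc k)
  have "near_energy n p u Q (t / 2 ^ k)
      \<le> ennreal (2 powr (real n + p)) * near_energy n p u Q (t / 2 ^ k / 2)"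
    by (rule near_energy_halving[OF assms])
  then have "ennreal ((2 powr (real n + p)) ^ k) * near_energy n p u Q (t / 2 ^ k)
      \<le> ennreal ((2 powr (real n + p)) ^ k) * (ennreal (2 powr (real n + p)) * near_energy n p u Q (t / 2 ^ k / 2))"
    by (rule mult_left_mono) simp
  also have "\<dots> = ennreal ((2 powr (real n + p)) ^ Suc k) * near_energy n p u Q (t / 2 ^ Suc k)"
    by (simp add: ennreal_mult mult_ac)
  finally show ?case
    using Suc.IH by (rule order_trans[rotated])
qed simp

section \<open>The fractional inequality on a single cube\<close>

text \<open>Says that the geometric series with ratio \<open>2 powr (- r)\<close> has sum at least
  \<open>1 / r\<close> when \<open>r > 0\<close>. It comes from \<open>exp (- t)\<close> being at
  least \<open>1 - t\<close> and \<open>ln 2\<close> at most 1.\<close>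

lemma one_minus_two_powr_le:
  fixes r :: real
  assumes "0 \<le> r"
  shows "1 - 2 powr (- r) \<le> r"
proof -
  have "1 - r \<le> 1 - r * ln 2"
    using assms ln2_le_25_over_36 mult_left_mono[of "ln 2" 1 r] by simp
  also have "\<dots> \<le> exp (- (r * ln 2))"
    using exp_ge_add_one_self[of "- (r * ln 2)"] by simp
  finally show ?thesis by (simp add: powr_def)
qed

lemma euclidean_dist_eq_0_imp_eq:
  assumes "euclidean_dist n x y = 0" "x \<in> space (leb_borel n)" "y \<in> space (leb_borel n)"
  shows "x = y"
  using assms by (auto simp: L2_set_eq_0_iff space_PiM PiE_iff intro!: extensionalityI[of x "{..<n}" y])

text \<open>The crude comparison with the sum norm is enough, because the resulting power of
  \<open>n\<close> is absorbed by the dimensional constant.\<close>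

lemma euclidean_dist_le_box:
  assumes "x \<in> PiE {..<n} (\<lambda>i. {a i .. a i + l})" "y \<in> PiE {..<n} (\<lambda>i. {a i .. a i + l})"
  shows "euclidean_dist n x y \<le> real n * l"
proof -
  have "euclidean_dist n x y \<le> (\<Sum>i<n. \<bar>x i - y i\<bar>)"
    by (rule L2_set_le_sum_abs)
  also have "\<dots> \<le> (\<Sum>i<n. l)"
  proof (rule sum_mono)
    fix i assume "i \<in> {..<n}"
    then have "x i \<in> {a i .. a i + l}" "y i \<in> {a i .. a i + l}"
      using assms by (auto simp: PiE_iff)
    then show "\<bar>x i - y i\<bar> \<le> l" by auto
  qed
  finally show ?thesis by simp
qed

text \<open>The weights \<open>(2 ^ k) powr s\<close> on the dyadic scales recover the singular kernel, while
  \<open>near_energy_halving\<close> bounds each weighted scale below by a term of a geometric series whose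
  ratio tends to 1 as \<open>\<delta>\<close> does; this is the source of the factor \<open>1 - \<delta>\<close>.\<close>
lemma fractional_energy_bound:
  fixes u :: "(nat \<Rightarrow> real) \<Rightarrow> real"
  assumes u[measurable]: "u \<in> borel_measurable (leb_borel n)" and p: "1 \<le> p"
    and Q: "Q = PiE {..<n} (\<lambda>i. {a i .. a i + l})" and l: "0 < l" and n: "1 \<le> n"
    and \<delta>: "0 < \<delta>" "\<delta> < 1"
  shows "(\<integral>\<^sup>+x\<in>Q. (\<integral>\<^sup>+y\<in>Q. ennreal (\<bar>u x - u y\<bar> powr p) \<partial>leb_borel n) \<partial>leb_borel n)
    \<le> ennreal (2 * (p * (1 - \<delta>)) * (real n * l) powr (real n + p * \<delta>)) *
      (\<integral>\<^sup>+x\<in>Q. (\<integral>\<^sup>+y\<in>Q. ennreal (\<bar>u x - u y\<bar> powr p / euclidean_dist n x y powr (real n + p * \<delta>))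
        \<partial>leb_borel n) \<partial>leb_borel n)"
    (is "?E \<le> _ * ?S")
proof -
  let ?P = "leb_borel n"
  let ?D = "euclidean_dist n"
  \<comment> \<open>\<open>T\<close> bounds the diameter of the cube, so the near energy at
    \<open>T\<close> is the full double integral. The ratio \<open>q\<close> satisfies
    \<open>q * 2 powr (n + p) = 2 powr s\<close>, which matches the halving constant with the
    weights \<open>(2 ^ k) powr s\<close>.\<close>
  define s r T q where "s = real n + p * \<delta>" and "r = p * (1 - \<delta>)" and "T = real n * l"
    and "q = 2 powr (- r)"
  define e where "e x y = \<bar>u x - u y\<bar> powr p" for x y
  have s1: "1 \<le> s" unfolding s_def using n p \<delta> mult_nonneg_nonneg[of p \<delta>] by linarith
  have r0: "0 < r" unfolding r_def using p \<delta> by simp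
  have T0: "0 < T" unfolding T_def using n l by simp
  have q: "0 < q" "q < 1" unfolding q_def using r0 by (auto simp: powr_less_one)
  have [measurable]: "Q \<in> sets ?P" unfolding Q by measurable
  interpret sigma_finite_measure ?P by (rule sigma_finite_leb_borel)
  have E: "?E = near_energy n p u Q T"
    unfolding near_energy_def
    by (intro nn_integral_cong, subst nn_integral_multc[symmetric], simp,
        intro nn_integral_cong) 
      (use euclidean_dist_le_box[of _ n a l] in \<open>auto simp: Q T_def split: split_indicator\<close>)
  have S: "?S = (\<integral>\<^sup>+x. (\<integral>\<^sup>+y. indicator Q x * indicator Q y * ennreal (e x y / ?D x y powr s) \<partial>?P) \<partial>?P)"
    unfolding e_def s_def
    by (intro nn_integral_cong) (auto simp: mult.commute split: split_indicator)
  \<comment> \<open>A pair at distance \<open>d\<close> is seen at scale \<open>k\<close> exactly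
    when \<open>2 ^ k\<close> is at most \<open>T / d\<close>, so its weights sum to at most
    \<open>2 * (T / d) powr s\<close>, a multiple of the kernel. On the diagonal
    \<open>e x y\<close> is 0 and both sides vanish.\<close>
  have pt: "(\<Sum>k<N. ennreal ((2 ^ k) powr s) * (indicator Q x * indicator Q y *
        indicator {..T / 2 ^ k} (?D x y) * ennreal (e x y)))
      \<le> ennreal (2 * T powr s) * (indicator Q x * indicator Q y * ennreal (e x y / ?D x y powr s))"
    if xy: "x \<in> space ?P" "y \<in> space ?P" for x y N
  proof (cases "?D x y = 0 \<or> x \<notin> Q \<or> y \<notin> Q")
    case True
    then have "x = y \<or> x \<notin> Q \<or> y \<notin> Q"
      using euclidean_dist_eq_0_imp_eq[OF _ xy] by blast
    then show ?thesis using p by (auto simp: e_def)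
  next
    case False
    then have D: "0 < ?D x y" using L2_set_nonneg[of "\<lambda>i. x i - y i" "{..<n}"] by linarith
    have "(\<Sum>k<N. ennreal ((2 ^ k) powr s) * (indicator Q x * indicator Q y *
        indicator {..T / 2 ^ k} (?D x y) * ennreal (e x y)))
      = (\<Sum>k<N. ennreal ((if 2 ^ k \<le> T / ?D x y then (2 ^ k) powr s else 0) * e x y))"
      using False D by (intro sum.cong) (auto simp: indicator_def field_simps ennreal_mult e_def)
    also have "\<dots> = ennreal ((\<Sum>k<N. if 2 ^ k \<le> T / ?D x y then (2 ^ k) powr s else 0) * e x y)"
      by (subst sum_ennreal) (auto simp: e_def sum_distrib_right)
    also have "\<dots> \<le> ennreal (2 * (T / ?D x y) powr s * e x y)"
      using D T0 s1 by (intro ennreal_leI mult_right_mono sum_dyadic_powr_le) (auto simp: e_def)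
    also have "\<dots> = ennreal (2 * T powr s) * (indicator Q x * indicator Q y * ennreal (e x y / ?D x y powr s))"
      using False D T0 by (simp add: ennreal_mult[symmetric] powr_divide e_def)
    finally show ?thesis .
  qed
  define K where "K x y = (indicator Q x * indicator Q y * ennreal (e x y / ?D x y powr s) :: ennreal)" for x y
  have Km: "(\<lambda>z. K (fst z) (snd z)) \<in> borel_measurable (?P \<Otimes>\<^sub>M ?P)"
    unfolding K_def e_def by measurable
  have Km1: "K x \<in> borel_measurable ?P" if "x \<in> space ?P" for x
    using measurable_compose[OF measurable_Pair1'[OF that] Km] by simp
  have Km2: "(\<lambda>x. \<integral>\<^sup>+y. K x y \<partial>?P) \<in> borel_measurable ?P"
    using Km by (intro borel_measurable_nn_integral) (simp add: case_prod_beta')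
  have upper: "(\<Sum>k<N. ennreal ((2 ^ k) powr s) * near_energy n p u Q (T / 2 ^ k)) \<le> ennreal (2 * T powr s) * ?S" for N
  proof -
    define G where "G k x y = (indicator Q x * indicator Q y *
        indicator {..T / 2 ^ k} (?D x y) * ennreal (e x y) :: ennreal)" for k :: nat and x y
    have Gm: "(\<lambda>z. G k (fst z) (snd z)) \<in> borel_measurable (?P \<Otimes>\<^sub>M ?P)" for k
      unfolding G_def e_def by measurable
    have Gm1: "G k x \<in> borel_measurable ?P" if "x \<in> space ?P" for k x
      using measurable_compose[OF measurable_Pair1'[OF that] Gm[of k]] by simp
    have Gm2: "(\<lambda>x. \<integral>\<^sup>+y. G k x y \<partial>?P) \<in> borel_measurable ?P" for k
      using Gm by (intro borel_measurable_nn_integral) (simp add: case_prod_beta')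
    have "(\<Sum>k<N. ennreal ((2 ^ k) powr s) * near_energy n p u Q (T / 2 ^ k))
        = (\<Sum>k<N. ennreal ((2 ^ k) powr s) * (\<integral>\<^sup>+x. (\<integral>\<^sup>+y. G k x y \<partial>?P) \<partial>?P))"
      unfolding near_energy_def G_def e_def ..
    also have "\<dots> = (\<integral>\<^sup>+x. (\<Sum>k<N. ennreal ((2 ^ k) powr s) * (\<integral>\<^sup>+y. G k x y \<partial>?P)) \<partial>?P)"
      using Gm2 by (subst nn_integral_sum) (auto simp: nn_integral_cmult)
    also have "\<dots> = (\<integral>\<^sup>+x. (\<integral>\<^sup>+y. (\<Sum>k<N. ennreal ((2 ^ k) powr s) * G k x y) \<partial>?P) \<partial>?P)"
      using Gm1 by (intro nn_integral_cong, subst nn_integral_sum) (auto simp: nn_integral_cmult)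
    also have "\<dots> \<le> (\<integral>\<^sup>+x. (\<integral>\<^sup>+y. ennreal (2 * T powr s) * K x y \<partial>?P) \<partial>?P)"
      unfolding G_def K_def by (intro nn_integral_mono pt)
    also have "\<dots> = (\<integral>\<^sup>+x. ennreal (2 * T powr s) * (\<integral>\<^sup>+y. K x y \<partial>?P) \<partial>?P)"
      by (intro nn_integral_cong nn_integral_cmult Km1)
    also have "\<dots> = ennreal (2 * T powr s) * ?S"
      unfolding S K_def[symmetric] by (intro nn_integral_cmult Km2)
    finally show ?thesis .
  qed
  \<comment> \<open>The weight of scale \<open>k\<close> equals \<open>q ^ k\<close> times the loss
    from halving \<open>k\<close> times, so this scale retains at least the share
    \<open>q ^ k\<close> of the full energy.\<close>
  have lower: "ennreal (q ^ k) * ?E \<le> ennreal ((2 ^ k) powr s) * near_energy n p u Q (T / 2 ^ k)" for k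
  proof -
    have "q * 2 powr (real n + p) = 2 powr s"
      unfolding q_def s_def r_def by (simp add: powr_add[symmetric] algebra_simps)
    moreover have "(2 ^ k) powr s = (2 powr s) ^ k"
      by (simp add: powr_power powr_powr powr_realpow[symmetric] mult.commute)
    ultimately have "q ^ k * (2 powr (real n + p)) ^ k = (2 ^ k) powr s"
      by (metis power_mult_distrib)
    then have "ennreal ((2 ^ k) powr s) = ennreal (q ^ k) * ennreal ((2 powr (real n + p)) ^ k)"
      using q by (simp add: ennreal_mult[symmetric])
    moreover have "?E \<le> ennreal ((2 powr (real n + p)) ^ k) * near_energy n p u Q (T / 2 ^ k)"
      unfolding E by (rule near_energy_halving_iterated[OF u p Q])
    ultimately show ?thesis
      by (simp add: mult.assoc mult_left_mono)
  qed
  \<comment> \<open>The bound in \<open>upper\<close> is uniform in \<open>N\<close>, so it passes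
    to the infinite series.\<close>
  have "(\<Sum>k. ennreal (q ^ k) * ?E) \<le> ennreal (2 * T powr s) * ?S"
    using upper sum_mono[OF lower] by (intro suminf_le_const summableI) (rule order_trans)
  moreover have "(\<Sum>k. ennreal (q ^ k)) = ennreal (1 / (1 - q))"
    using q by (intro suminf_ennreal_eq geometric_sums) auto
  ultimately have *: "ennreal (1 / (1 - q)) * ?E \<le> ennreal (2 * T powr s) * ?S"
    by simp
  \<comment> \<open>Here the factor \<open>p * (1 - \<delta>)\<close> arises: the series sums to at
    least \<open>1 / r\<close>, and multiplying by \<open>r\<close> moves it to the right-hand
    side.\<close>
  have "1 \<le> r * (1 / (1 - q))"
    using one_minus_two_powr_le[of r] r0 q unfolding q_def by simp
  then have "1 \<le> ennreal r * ennreal (1 / (1 - q))"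
    using r0 q by (simp add: ennreal_mult[symmetric])
  then have "?E \<le> ennreal r * ennreal (1 / (1 - q)) * ?E"
    using mult_right_mono[of 1 _ ?E] by simp
  also have "\<dots> \<le> ennreal r * (ennreal (2 * T powr s) * ?S)"
    using * by (simp add: mult.assoc mult_left_mono)
  also have "\<dots> = ennreal (2 * r * T powr s) * ?S"
  proof -
    have "ennreal r * ennreal (2 * T powr s) = ennreal (2 * r * T powr s)"
      using r0 by (simp add: ennreal_mult[symmetric] mult_ac)
    then show ?thesis by (simp only: mult.assoc[symmetric])
  qed
  finally show ?thesis unfolding r_def T_def s_def .
qed

section \<open>Mean oscillation and product measures\<close>

text \<open>Restriction to a set is modelled by an indicator density, which leaves the space and the
  sigma-algebra unchanged, so measurability facts carry over.\<close>

lemma nn_integral_density_indicator: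
  "A \<in> sets M \<Longrightarrow> f \<in> borel_measurable M \<Longrightarrow>
    (\<integral>\<^sup>+x. f x \<partial>density M (indicator A)) = (\<integral>\<^sup>+x\<in>A. f x \<partial>M)"
  by (simp add: nn_integral_density mult.commute)

lemma emeasure_space_density_indicator:
  "A \<in> sets M \<Longrightarrow> emeasure (density M (indicator A)) (space M) = emeasure M A"
  by (simp add: emeasure_density sets.Int_space_eq2 flip: indicator_inter_arith)

lemma finite_measure_density_indicator:
  "A \<in> sets M \<Longrightarrow> emeasure M A < \<infinity> \<Longrightarrow> finite_measure (density M (indicator A))"
  by (intro finite_measureI) (auto simp: emeasure_space_density_indicator)

text \<open>\<open>g x\<close> minus the mean is the average of \<open>g x - g y\<close> over
  \<open>y\<close>, and the absolute value goes under that average. Both sides are multiplied by the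
  total mass, which avoids dividing extended reals.\<close>

lemma mean_oscillation_le:
  fixes g :: "'a \<Rightarrow> real"
  assumes "finite_measure M" and g: "integrable M g" and pos: "0 < measure M (space M)"
  shows "ennreal (measure M (space M)) *
      (\<integral>\<^sup>+x. ennreal \<bar>g x - (1 / measure M (space M)) * (\<integral>y. g y \<partial>M)\<bar> \<partial>M)
    \<le> (\<integral>\<^sup>+x. (\<integral>\<^sup>+y. ennreal \<bar>g x - g y\<bar> \<partial>M) \<partial>M)"
proof -
  interpret finite_measure M by fact
  let ?V = "measure M (space M)"
  have [measurable]: "g \<in> borel_measurable M" using g by simp
  have "ennreal ?V * ennreal \<bar>g x - (1 / ?V) * (\<integral>y. g y \<partial>M)\<bar> \<le> (\<integral>\<^sup>+y. ennreal \<bar>g x - g y\<bar> \<partial>M)" for x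
  proof -
    have "(\<integral>y. g x - g y \<partial>M) = ?V * (g x - (1 / ?V) * (\<integral>y. g y \<partial>M))"
      using g pos by (subst Bochner_Integration.integral_diff) (auto simp: field_simps)
    then have "ennreal ?V * ennreal \<bar>g x - (1 / ?V) * (\<integral>y. g y \<partial>M)\<bar> = ennreal (norm (\<integral>y. g x - g y \<partial>M))"
      by (simp add: ennreal_mult[symmetric] abs_mult)
    also have "\<dots> \<le> (\<integral>\<^sup>+y. norm (g x - g y) \<partial>M)"
      using g by (intro integral_norm_bound_ennreal) auto
    finally show ?thesis by simp
  qed
  then show ?thesis
    by (subst nn_integral_cmult[symmetric]) (auto intro!: nn_integral_mono)
qed

text \<open>Passing through \<open>(y1, x2)\<close> changes one coordinate at a time. The first
  difference does not involve \<open>y2\<close> and the second does not involve \<open>x1\<close>;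
  integrating out the absent variable yields the total masses of \<open>M2\<close> and
  \<open>M1\<close>.\<close>

lemma pair_oscillation_le:
  fixes g :: "'a \<times> 'b \<Rightarrow> real"
  assumes "sigma_finite_measure M1" "sigma_finite_measure M2"
    and g[measurable]: "g \<in> borel_measurable (M1 \<Otimes>\<^sub>M M2)"
  shows "(\<integral>\<^sup>+z. (\<integral>\<^sup>+w. ennreal \<bar>g z - g w\<bar> \<partial>(M1 \<Otimes>\<^sub>M M2)) \<partial>(M1 \<Otimes>\<^sub>M M2))
    \<le> emeasure M2 (space M2) * (\<integral>\<^sup>+x2. \<integral>\<^sup>+x1. \<integral>\<^sup>+y1. ennreal \<bar>g (x1, x2) - g (y1, x2)\<bar> \<partial>M1 \<partial>M1 \<partial>M2)
    + emeasure M1 (space M1) * (\<integral>\<^sup>+y1. \<integral>\<^sup>+y2. \<integral>\<^sup>+x2. ennreal \<bar>g (y1, x2) - g (y1, y2)\<bar> \<partial>M2 \<partial>M2 \<partial>M1)"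
proof -
  interpret M1: sigma_finite_measure M1 by fact
  interpret M2: sigma_finite_measure M2 by fact
  interpret P: pair_sigma_finite M1 M2 ..
  have gm1: "(\<lambda>x1. g (x1, x2)) \<in> borel_measurable M1" if "x2 \<in> space M2" for x2
    using measurable_compose[OF measurable_Pair2'[OF that] g] by simp
  have gm2: "(\<lambda>x2. g (x1, x2)) \<in> borel_measurable M2" if "x1 \<in> space M1" for x1
    using measurable_compose[OF measurable_Pair1'[OF that] g] by simp
  have 1: "(\<integral>\<^sup>+x1. \<integral>\<^sup>+x2. \<integral>\<^sup>+y1. ennreal \<bar>g (x1, x2) - g (y1, x2)\<bar> \<partial>M1 \<partial>M2 \<partial>M1)
      = (\<integral>\<^sup>+x2. \<integral>\<^sup>+x1. \<integral>\<^sup>+y1. ennreal \<bar>g (x1, x2) - g (y1, x2)\<bar> \<partial>M1 \<partial>M1 \<partial>M2)"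
    by (rule P.Fubini'[symmetric]) measurable
  \<comment> \<open>Once \<open>x2\<close> and \<open>y1\<close> are exchanged, the two sides differ
    by swapping the names \<open>x2\<close> and \<open>y2\<close>, under which the absolute value is
    symmetric.\<close>
  have 2: "(\<integral>\<^sup>+x2. \<integral>\<^sup>+y1. \<integral>\<^sup>+y2. ennreal \<bar>g (y1, x2) - g (y1, y2)\<bar> \<partial>M2 \<partial>M1 \<partial>M2)
      = (\<integral>\<^sup>+y1. \<integral>\<^sup>+y2. \<integral>\<^sup>+x2. ennreal \<bar>g (y1, x2) - g (y1, y2)\<bar> \<partial>M2 \<partial>M2 \<partial>M1)"
    by (subst P.Fubini', measurable) (simp add: abs_minus_commute)
  have "(\<integral>\<^sup>+z. (\<integral>\<^sup>+w. ennreal \<bar>g z - g w\<bar> \<partial>(M1 \<Otimes>\<^sub>M M2)) \<partial>(M1 \<Otimes>\<^sub>M M2))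
    = (\<integral>\<^sup>+x1. \<integral>\<^sup>+x2. \<integral>\<^sup>+w. ennreal \<bar>g (x1, x2) - g w\<bar> \<partial>(M1 \<Otimes>\<^sub>M M2) \<partial>M2 \<partial>M1)"
  proof -
    show ?thesis by (subst M2.nn_integral_fst[symmetric]) measurable
  qed
  also have "\<dots> = (\<integral>\<^sup>+x1. \<integral>\<^sup>+x2. \<integral>\<^sup>+y1. \<integral>\<^sup>+y2. ennreal \<bar>g (x1, x2) - g (y1, y2)\<bar> \<partial>M2 \<partial>M1 \<partial>M2 \<partial>M1)"
    by (intro nn_integral_cong, subst M2.nn_integral_fst[symmetric]) auto
  also have "\<dots> \<le> (\<integral>\<^sup>+x1. \<integral>\<^sup>+x2. \<integral>\<^sup>+y1. \<integral>\<^sup>+y2.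
      ennreal \<bar>g (x1, x2) - g (y1, x2)\<bar> + ennreal \<bar>g (y1, x2) - g (y1, y2)\<bar> \<partial>M2 \<partial>M1 \<partial>M2 \<partial>M1)"
    by (intro nn_integral_mono) (simp add: ennreal_plus[symmetric] ennreal_leI del: ennreal_plus)
  also have "\<dots> = (\<integral>\<^sup>+x1. \<integral>\<^sup>+x2. \<integral>\<^sup>+y1. 
      ennreal \<bar>g (x1, x2) - g (y1, x2)\<bar> * emeasure M2 (space M2)
      + (\<integral>\<^sup>+y2. ennreal \<bar>g (y1, x2) - g (y1, y2)\<bar> \<partial>M2) \<partial>M1 \<partial>M2 \<partial>M1)"
    using gm2 by (intro nn_integral_cong, subst nn_integral_add) auto
  also have "\<dots> = (\<integral>\<^sup>+x1. \<integral>\<^sup>+x2.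
      (\<integral>\<^sup>+y1. ennreal \<bar>g (x1, x2) - g (y1, x2)\<bar> \<partial>M1) * emeasure M2 (space M2)
      + (\<integral>\<^sup>+y1. \<integral>\<^sup>+y2. ennreal \<bar>g (y1, x2) - g (y1, y2)\<bar> \<partial>M2 \<partial>M1) \<partial>M2 \<partial>M1)"
    using gm1 by (intro nn_integral_cong, subst nn_integral_add) (auto simp: nn_integral_multc)
  also have "\<dots> = (\<integral>\<^sup>+x1.
      (\<integral>\<^sup>+x2. \<integral>\<^sup>+y1. ennreal \<bar>g (x1, x2) - g (y1, x2)\<bar> \<partial>M1 \<partial>M2) * emeasure M2 (space M2)
      + (\<integral>\<^sup>+x2. \<integral>\<^sup>+y1. \<integral>\<^sup>+y2. ennreal \<bar>g (y1, x2) - g (y1, y2)\<bar> \<partial>M2 \<partial>M1 \<partial>M2) \<partial>M1)"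
    by (intro nn_integral_cong, subst nn_integral_add) (auto simp: nn_integral_multc)
  also have "\<dots> = 
      (\<integral>\<^sup>+x1. \<integral>\<^sup>+x2. \<integral>\<^sup>+y1. ennreal \<bar>g (x1, x2) - g (y1, x2)\<bar> \<partial>M1 \<partial>M2 \<partial>M1) * emeasure M2 (space M2)
      + (\<integral>\<^sup>+x2. \<integral>\<^sup>+y1. \<integral>\<^sup>+y2. ennreal \<bar>g (y1, x2) - g (y1, y2)\<bar> \<partial>M2 \<partial>M1 \<partial>M2) * emeasure M1 (space M1)"
    by (subst nn_integral_add) (auto simp: nn_integral_multc)
  finally show ?thesis unfolding 1 2 by (simp add: mult.commute)
qed

text \<open>Turns the iterated triple integral into an integral against one measure, so that
  Jensen's inequality can be applied to all three variables together.\<close>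

lemma nn_integral_triple_density_indicator:
  fixes h :: "'b \<times> 'a \<times> 'a \<Rightarrow> ennreal"
  assumes "sigma_finite_measure L"
    and A[measurable]: "A \<in> sets L" and fA: "emeasure L A < \<infinity>"
    and B[measurable]: "B \<in> sets M"
    and h[measurable]: "h \<in> borel_measurable (M \<Otimes>\<^sub>M (L \<Otimes>\<^sub>M L))"
  shows "(\<integral>\<^sup>+z. h z \<partial>(density M (indicator B) \<Otimes>\<^sub>M (density L (indicator A) \<Otimes>\<^sub>M density L (indicator A))))
    = (\<integral>\<^sup>+y\<in>B. (\<integral>\<^sup>+x\<in>A. (\<integral>\<^sup>+x'\<in>A. h (y, x, x') \<partial>L) \<partial>L) \<partial>M)"
proof -
  interpret L: sigma_finite_measure L by fact
  let ?L = "density L (indicator A)" and ?M = "density M (indicator B)"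
  interpret L': finite_measure ?L using A fA by (rule finite_measure_density_indicator)
  interpret LL: pair_sigma_finite ?L ?L ..
  have "(\<integral>\<^sup>+z. h z \<partial>(?M \<Otimes>\<^sub>M (?L \<Otimes>\<^sub>M ?L))) = (\<integral>\<^sup>+y. \<integral>\<^sup>+w. h (y, w) \<partial>(?L \<Otimes>\<^sub>M ?L) \<partial>?M)"
    by (rule sigma_finite_measure.nn_integral_fst[OF LL.sigma_finite_measure_axioms, symmetric]) (simp cong: measurable_cong_sets sets_pair_measure_cong)
  also have "\<dots> = (\<integral>\<^sup>+y. \<integral>\<^sup>+x. \<integral>\<^sup>+x'. h (y, x, x') \<partial>?L \<partial>?L \<partial>?M)"
    by (intro nn_integral_cong L'.nn_integral_fst[symmetric])
      (simp cong: measurable_cong_sets sets_pair_measure_cong)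
  also have "\<dots> = (\<integral>\<^sup>+y. \<integral>\<^sup>+x. (\<integral>\<^sup>+x'\<in>A. h (y, x, x') \<partial>L) \<partial>?L \<partial>?M)"
    by (intro nn_integral_cong nn_integral_density_indicator) (auto simp: measurable_split_conv)
  also have "\<dots> = (\<integral>\<^sup>+y. (\<integral>\<^sup>+x\<in>A. (\<integral>\<^sup>+x'\<in>A. h (y, x, x') \<partial>L) \<partial>L) \<partial>?M)"
    by (intro nn_integral_cong nn_integral_density_indicator) auto
  also have "\<dots> = (\<integral>\<^sup>+y\<in>B. (\<integral>\<^sup>+x\<in>A. (\<integral>\<^sup>+x'\<in>A. h (y, x, x') \<partial>L) \<partial>L) \<partial>M)"
    by (intro nn_integral_density_indicator) auto
  finally show ?thesis .
qed

section \<open>The dimensional constant and the contribution of one variable\<close>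

lemma emeasure_cube:
  assumes "0 \<le> l"
  shows "emeasure (leb_borel n) (PiE {..<n} (\<lambda>i. {a i .. a i + l})) = ennreal (l ^ n)"
proof -
  interpret product_sigma_finite "\<lambda>_::nat. lborel :: real measure"
    by (rule product_sigma_finite_lborel)
  show ?thesis
    using assms by (subst emeasure_PiM) (auto simp: ennreal_power)
qed

text \<open>A \<open>p\<close>-th root will be taken, and the outcome may depend on \<open>n\<close>
  only, so the bound has to be a \<open>p\<close>-th power of a function of \<open>n\<close>. The
  base \<open>n\<close> is raised to \<open>n + 1\<close>, and then the exponent to
  \<open>(n + 1) * p\<close>, while \<open>2 * p\<close> is at most \<open>4 powr p\<close>.\<close>

lemma dimensional_constant_bound:
  fixes p \<delta> :: real
  assumes p: "1 \<le> p" and \<delta>: "0 < \<delta>" "\<delta> < 1"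
  shows "2 * p * real n powr (real n + p * \<delta>) \<le> (4 * real (n + 1) ^ (n + 1)) powr p"
proof -
  have "2 powr 1 \<le> 2 powr p" using p by (intro powr_mono) auto
  \<comment> \<open>Linearising the exponential gives \<open>2 powr (p - 1)\<close> at least
    \<open>1 + (p - 1) * ln 2\<close>, and \<open>ln 2\<close> is at least 1/2.\<close>
  moreover have "p \<le> 2 powr p"
  proof -
    have "1 + (p - 1) * ln 2 \<le> 2 powr (p - 1)"
      using exp_ge_add_one_self[of "(p - 1) * ln 2"] by (simp add: powr_def)
    moreover have "(p - 1) * (1/2) \<le> (p - 1) * ln 2"
      using p ln2_ge_two_thirds by (intro mult_left_mono) auto
    ultimately show ?thesis by (simp add: powr_diff field_simps)
  qed
  ultimately have "2 * p \<le> 2 powr p * 2 powr p"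
    using p by (intro mult_mono) auto
  also have "\<dots> = 4 powr p" by (simp flip: powr_mult)
  finally have 1: "2 * p \<le> 4 powr p" .
  have "real n powr (real n + p * \<delta>) \<le> real (n + 1) powr (real n + p * \<delta>)"
    using p \<delta> by (intro powr_mono2) auto
  also have "\<dots> \<le> real (n + 1) powr (real (n + 1) * p)"
  proof (intro powr_mono)
    have "real n * 1 \<le> real n * p" "p * \<delta> \<le> p * 1"
      using p \<delta> by (simp_all add: mult_le_cancel_left1)
    then show "real n + p * \<delta> \<le> real (n + 1) * p" by (simp add: algebra_simps)
  qed simp
  also have "\<dots> = (real (n + 1) ^ (n + 1)) powr p"
    by (simp only: powr_powr[symmetric] powr_realpow[of "real (n + 1)" "n + 1"] of_nat_0_less_iff)
  finally have "2 * p * real n powr (real n + p * \<delta>) \<le> 4 powr p * (real (n + 1) ^ (n + 1)) powr p"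
    using 1 p by (intro mult_mono) auto
  then show ?thesis by (simp add: powr_mult)
qed

definition poincare_const :: "nat \<Rightarrow> real" where
  "poincare_const n = 4 * real (n + 1) ^ (n + 1)"

lemma poincare_const_pos: "0 < poincare_const n"
  unfolding poincare_const_def by simp

text \<open>The cube variable comes first and the second factor is an arbitrary measure, so that the
  bound serves \<open>a1\<close> directly and \<open>a2\<close> after exchanging coordinates. The
  factor \<open>l ^ n * l ^ n * b\<close> is the total mass of the triples
  \<open>(y, x, x')\<close>.\<close>

lemma fractional_term_bound:
  fixes g :: "(nat \<Rightarrow> real) \<times> 'b \<Rightarrow> real"
  assumes g[measurable]: "g \<in> borel_measurable (leb_borel n \<Otimes>\<^sub>M M)"
    and B[measurable]: "B \<in> sets M" and eB: "emeasure M B = ennreal b" "0 < b"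
    and Q: "Q = PiE {..<n} (\<lambda>i. {a i .. a i + l})" and l: "0 < l" and n: "1 \<le> n"
    and p: "1 \<le> p" and \<delta>: "0 < \<delta>" "\<delta> < 1"
  shows "(\<integral>\<^sup>+y\<in>B. (\<integral>\<^sup>+x\<in>Q. (\<integral>\<^sup>+x'\<in>Q. ennreal \<bar>g (x, y) - g (x', y)\<bar> \<partial>leb_borel n) \<partial>leb_borel n) \<partial>M)
    \<le> ennreal (l ^ n * l ^ n * b) * (ennreal (poincare_const n * (1 - \<delta>) powr (1 / p)) *
        (ennreal (l powr \<delta>) * ennreal_powr ((\<integral>\<^sup>+y\<in>B. (\<integral>\<^sup>+x\<in>Q. (\<integral>\<^sup>+x'\<in>Q.
          ennreal (\<bar>g (x, y) - g (x', y)\<bar> powr p / euclidean_dist n x x' powr (real n + p * \<delta>))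
          \<partial>leb_borel n) \<partial>leb_borel n) \<partial>M) / ennreal (l ^ n * b)) (1 / p)))"
    (is "?H \<le> ennreal ?W * (ennreal (?c * _) * (_ * ennreal_powr (?S / ennreal ?V) _))")
proof (cases "?S = top")
  case True
  \<comment> \<open>An infinite seminorm makes the whole right-hand side infinite, since all the
    other factors are positive.\<close>
  have "ennreal_powr (?S / ennreal ?V) (1 / p) = top"
    unfolding True ennreal_powr_def by (simp add: ennreal_top_divide)
  then show ?thesis
    using l eB \<delta> poincare_const_pos[of n] by (simp add: ennreal_mult_eq_top_iff ennreal_mult_top)
next
  case False
  let ?L = "leb_borel n"
  define h where "h z = \<bar>g (fst (snd z), fst z) - g (snd (snd z), fst z)\<bar>" for z
  have h[measurable]: "h \<in> borel_measurable (M \<Otimes>\<^sub>M (?L \<Otimes>\<^sub>M ?L))"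
    unfolding h_def by measurable
  have Qm[measurable]: "Q \<in> sets ?L" unfolding Q by measurable
  have eQ: "emeasure ?L Q = ennreal (l ^ n)"
    unfolding Q using l by (intro emeasure_cube) simp
  interpret L: sigma_finite_measure ?L by (rule sigma_finite_leb_borel)
  let ?DL = "density ?L (indicator Q)" and ?DM = "density M (indicator B)"
  define N where "N = ?DM \<Otimes>\<^sub>M (?DL \<Otimes>\<^sub>M ?DL)"
  interpret L': finite_measure ?DL using eQ by (intro finite_measure_density_indicator) auto
  interpret LL: pair_sigma_finite ?DL ?DL ..
  have hN: "h \<in> borel_measurable N"
    unfolding N_def by (simp cong: measurable_cong_sets sets_pair_measure_cong)
  have triple: "(\<integral>\<^sup>+z. k z \<partial>N) = (\<integral>\<^sup>+y\<in>B. (\<integral>\<^sup>+x\<in>Q. (\<integral>\<^sup>+x'\<in>Q. k (y, x, x') \<partial>?L) \<partial>?L) \<partial>M)"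
    if "k \<in> borel_measurable (M \<Otimes>\<^sub>M (?L \<Otimes>\<^sub>M ?L))" for k
    unfolding N_def using eQ that
    by (intro nn_integral_triple_density_indicator L.sigma_finite_measure_axioms) auto
  have W: "emeasure N (space N) = ennreal ?W"
  proof -
    have "emeasure (?DL \<Otimes>\<^sub>M ?DL) (space (?DL \<Otimes>\<^sub>M ?DL)) = emeasure ?DL (space ?DL) * emeasure ?DL (space ?DL)"
      unfolding space_pair_measure by (rule L'.emeasure_pair_measure_Times) (rule sets.top)+
    moreover have "emeasure N (space N) = emeasure ?DM (space ?DM) * emeasure (?DL \<Otimes>\<^sub>M ?DL) (space (?DL \<Otimes>\<^sub>M ?DL))"
      unfolding N_def space_pair_measure[of ?DM]
      by (rule sigma_finite_measure.emeasure_pair_measure_Times[OF LL.sigma_finite_measure_axioms]) (rule sets.top)+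
    ultimately have "emeasure N (space N) = ennreal b * (ennreal (l ^ n) * ennreal (l ^ n))"
      by (simp only: space_density emeasure_space_density_indicator[OF Qm] emeasure_space_density_indicator[OF B] eQ eB)
    then show ?thesis
      using eB l by (simp add: ennreal_mult[symmetric] mult_ac)
  qed
  obtain S where S: "?S = ennreal S" "0 \<le> S" using False by (cases ?S) auto
  have V: "0 < ?V" using l eB by simp
  define \<sigma> where "\<sigma> = S / ?V"
  have \<sigma>0: "0 \<le> \<sigma>" unfolding \<sigma>_def using S V by simp
  \<comment> \<open>The claimed right-hand side divided by the total mass \<open>?W\<close>, that
    is, the bound to be shown for the mean of \<open>h\<close>.\<close>
  define A where "A = ?c * (1 - \<delta>) powr (1 / p) * l powr \<delta> * \<sigma> powr (1 / p)"
  have A0: "0 \<le> A" unfolding A_def using poincare_const_pos[of n] by simp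
  let ?K = "2 * (p * (1 - \<delta>)) * (real n * l) powr (real n + p * \<delta>)"
  have K0: "0 \<le> ?K" using p \<delta> by simp
  \<comment> \<open>One factor \<open>l ^ n\<close> comes from
    \<open>l powr (n + p * \<delta>)\<close>, the other one, with \<open>b\<close>, from
    \<open>S = \<sigma> * ?V\<close>; together they make up \<open>?W\<close>.\<close>
  have Ap: "?K * S \<le> A powr p * ?W"
  proof -
    have "?K * S = (2 * p * real n powr (real n + p * \<delta>)) * ((1 - \<delta>) * l powr (p * \<delta>) * \<sigma> * ?W)"
      unfolding \<sigma>_def using l eB n by (simp add: powr_mult powr_add powr_realpow field_simps)
    also have "\<dots> \<le> ?c powr p * ((1 - \<delta>) * l powr (p * \<delta>) * \<sigma> * ?W)"
      unfolding poincare_const_def using \<delta> \<sigma>0 l eB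
      by (intro mult_right_mono dimensional_constant_bound p \<delta>) auto
    also have "\<dots> = A powr p * ?W"
      unfolding A_def using p \<delta> \<sigma>0 by (simp add: powr_mult powr_powr mult_ac)
    finally show ?thesis .
  qed
  have P: "(\<integral>\<^sup>+z. ennreal (h z powr p) \<partial>N) \<le> ennreal ?K * ?S"
  proof -
    have gs: "(\<lambda>x. g (x, y)) \<in> borel_measurable ?L" if "y \<in> space M" for y
      using measurable_compose[OF measurable_Pair2'[OF that] g] by simp
    define k where "k z = ennreal (h z powr p /
      euclidean_dist n (fst (snd z)) (snd (snd z)) powr (real n + p * \<delta>))" for z
    have [measurable]: "k \<in> borel_measurable (M \<Otimes>\<^sub>M (?L \<Otimes>\<^sub>M ?L))"
      unfolding k_def by measurable
    have "(\<integral>\<^sup>+z. ennreal (h z powr p) \<partial>N)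
      = (\<integral>\<^sup>+y\<in>B. (\<integral>\<^sup>+x\<in>Q. (\<integral>\<^sup>+x'\<in>Q. ennreal (h (y, x, x') powr p) \<partial>?L) \<partial>?L) \<partial>M)"
      by (rule triple) measurable
    also have "\<dots> = (\<integral>\<^sup>+y\<in>B. (\<integral>\<^sup>+x\<in>Q. (\<integral>\<^sup>+x'\<in>Q. ennreal (\<bar>g (x, y) - g (x', y)\<bar> powr p) \<partial>?L) \<partial>?L) \<partial>M)"
      unfolding h_def by simp
    also have "\<dots> \<le> (\<integral>\<^sup>+y. ennreal ?K * ((\<integral>\<^sup>+x\<in>Q. (\<integral>\<^sup>+x'\<in>Q. k (y, x, x') \<partial>?L) \<partial>?L) * indicator B y) \<partial>M)"
      unfolding k_def h_def fst_conv snd_conv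
      by (rule nn_integral_mono, subst mult.assoc[symmetric])
        (rule mult_right_mono[OF fractional_energy_bound[OF gs p Q l n \<delta>]], simp_all)
    also have "\<dots> = ennreal ?K * (\<integral>\<^sup>+y\<in>B. (\<integral>\<^sup>+x\<in>Q. (\<integral>\<^sup>+x'\<in>Q. k (y, x, x') \<partial>?L) \<partial>?L) \<partial>M)"
      by (rule nn_integral_cmult) measurable
    also have "(\<integral>\<^sup>+y\<in>B. (\<integral>\<^sup>+x\<in>Q. (\<integral>\<^sup>+x'\<in>Q. k (y, x, x') \<partial>?L) \<partial>?L) \<partial>M) = ?S"
      unfolding k_def h_def by simp
    finally show ?thesis .
  qed
  have H: "?H = (\<integral>\<^sup>+z. ennreal (h z) \<partial>N)"
    by (subst triple) (auto simp: h_def)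
  have "?H \<le> ennreal (A * ?W)"
  proof (rule ennreal_le_epsilon)
    fix e :: real assume e: "0 < e"
    have W0: "0 < ?W" using l eB by simp
    \<comment> \<open>\<open>A\<close> is 0 when the seminorm vanishes, whereas the Jensen lemma
      asks for a positive bound; hence the enlargement, which adds exactly \<open>e\<close> after
      multiplication by \<open>?W\<close>.\<close>
    define A' where "A' = A + e / ?W"
    have A': "A \<le> A'" "0 < A'" unfolding A'_def using e W0 A0 by (auto intro: add_nonneg_pos)
    have "?K * S \<le> A' powr p * ?W"
      using Ap mult_right_mono[OF powr_mono2[of p A A'], of ?W] p A0 A' W0 by simp
    then have "ennreal ?K * ?S \<le> ennreal (A' powr p) * emeasure N (space N)"
      unfolding W S by (subst (1 2) ennreal_mult[symmetric]) (use K0 S W0 in \<open>auto intro!: ennreal_leI\<close>)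
    with P have "(\<integral>\<^sup>+z. ennreal (h z powr p) \<partial>N) \<le> ennreal (A' powr p) * emeasure N (space N)"
      by (rule order_trans)
    then have "(\<integral>\<^sup>+z. ennreal (h z) \<partial>N) \<le> ennreal A' * emeasure N (space N)"
      by (rule nn_integral_le_of_powr_mean_le[OF hN _ p A'(2), rotated]) (simp add: h_def)
    then have "?H \<le> ennreal A' * ennreal ?W"
      by (simp only: H W)
    also have "\<dots> = ennreal (A' * ?W)" using A' W0 by (simp add: ennreal_mult)
    also have "A' * ?W = A * ?W + e"
      unfolding A'_def distrib_right using W0 by (metis less_irrefl nonzero_eq_divide_eq)
    also have "ennreal (A * ?W + e) = ennreal (A * ?W) + ennreal e"
      using A0 W0 e by (intro ennreal_plus) auto
    finally show "?H \<le> ennreal (A * ?W) + ennreal e" .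
  qed
  also have "ennreal (A * ?W) = ennreal ?W * (ennreal (?c * (1 - \<delta>) powr (1 / p)) *
        (ennreal (l powr \<delta>) * ennreal_powr (?S / ennreal ?V) (1 / p)))"
  proof -
    have "ennreal_powr (?S / ennreal ?V) (1 / p) = ennreal (\<sigma> powr (1 / p))"
      unfolding S \<sigma>_def ennreal_powr_def using S V by (simp add: divide_ennreal)
    then show ?thesis
      unfolding A_def using l eB poincare_const_pos[of n]
      by (simp add: ennreal_mult[symmetric] mult_ac)
  qed
  finally show ?thesis .
qed

section \<open>Oscillation on a rectangle\<close>

text \<open>\<open>mean_oscillation_le\<close> followed by \<open>pair_oscillation_le\<close>, both
  for Lebesgue measure restricted to the rectangle. They fit together because this restriction is
  the product of the restrictions to \<open>I1\<close> and \<open>I2\<close>, which is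
  \<open>DD\<close>.\<close>

lemma rectangle_oscillation_le:
  fixes g :: "(nat \<Rightarrow> real) \<times> (nat \<Rightarrow> real) \<Rightarrow> real"
  defines "L \<equiv> leb_borel"
  assumes g[measurable]: "g \<in> borel_measurable (L n1 \<Otimes>\<^sub>M L n2)"
    and I1[measurable]: "I1 \<in> sets (L n1)" and e1: "emeasure (L n1) I1 = ennreal v1" "0 < v1"
    and I2[measurable]: "I2 \<in> sets (L n2)" and e2: "emeasure (L n2) I2 = ennreal v2" "0 < v2"
    and int: "set_integrable (L n1 \<Otimes>\<^sub>M L n2) (I1 \<times> I2) g"
  defines "m \<equiv> (1 / (v1 * v2)) * (LINT z:I1 \<times> I2|L n1 \<Otimes>\<^sub>M L n2. g z)"
  shows "ennreal (v1 * v2) * (\<integral>\<^sup>+z\<in>I1 \<times> I2. ennreal \<bar>g z - m\<bar> \<partial>(L n1 \<Otimes>\<^sub>M L n2))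
    \<le> ennreal v2 * (\<integral>\<^sup>+x2\<in>I2. (\<integral>\<^sup>+x1\<in>I1. (\<integral>\<^sup>+y1\<in>I1. ennreal \<bar>g (x1, x2) - g (y1, x2)\<bar> \<partial>L n1) \<partial>L n1) \<partial>L n2)
    + ennreal v1 * (\<integral>\<^sup>+y1\<in>I1. (\<integral>\<^sup>+y2\<in>I2. (\<integral>\<^sup>+x2\<in>I2. ennreal \<bar>g (y1, x2) - g (y1, y2)\<bar> \<partial>L n2) \<partial>L n2) \<partial>L n1)"
proof -
  interpret L1: sigma_finite_measure "L n1" unfolding L_def by (rule sigma_finite_leb_borel)
  interpret L2: sigma_finite_measure "L n2" unfolding L_def by (rule sigma_finite_leb_borel)
  let ?D1 = "density (L n1) (indicator I1)" and ?D2 = "density (L n2) (indicator I2)"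
  let ?R = "I1 \<times> I2" and ?LL = "L n1 \<Otimes>\<^sub>M L n2"
  interpret D1: finite_measure ?D1 using e1 by (intro finite_measure_density_indicator) auto
  interpret D2: finite_measure ?D2 using e2 by (intro finite_measure_density_indicator) auto
  have R[measurable]: "?R \<in> sets ?LL" by measurable
  have DD: "?D1 \<Otimes>\<^sub>M ?D2 = density ?LL (indicator ?R)"
    by (subst pair_measure_density)
      (auto intro!: density_cong simp: L2.sigma_finite_measure_axioms D2.sigma_finite_measure_axioms
        indicator_times case_prod_beta')
  have eR: "emeasure ?LL ?R = ennreal (v1 * v2)"
    using e1 e2 by (simp add: L2.emeasure_pair_measure_Times ennreal_mult)
  interpret DD: finite_measure "density ?LL (indicator ?R)"
    using eR by (intro finite_measure_density_indicator) auto
  have mR: "measure (density ?LL (indicator ?R)) (space (density ?LL (indicator ?R))) = v1 * v2"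
    unfolding measure_def space_density emeasure_space_density_indicator[OF R] eR using e1 e2 by simp
  \<comment> \<open>Bochner integrals against a density are computed with a real-valued density, so
    the indicator is first written as one.\<close>
  have ind: "indicator ?R = (\<lambda>z. ennreal (indicator ?R z))"
    by (auto split: split_indicator)
  have intD: "integrable (density ?LL (indicator ?R)) g"
    unfolding ind using int by (subst integrable_density) (auto simp: set_integrable_def)
  have mD: "(\<integral>z. g z \<partial>density ?LL (indicator ?R)) = (LINT z:?R|?LL. g z)"
    unfolding ind by (subst integral_density) (auto simp: set_lebesgue_integral_def)
  have "ennreal (v1 * v2) * (\<integral>\<^sup>+z\<in>?R. ennreal \<bar>g z - m\<bar> \<partial>?LL)
    = ennreal (v1 * v2) * (\<integral>\<^sup>+z. ennreal \<bar>g z - m\<bar> \<partial>density ?LL (indicator ?R))"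
    by (subst nn_integral_density_indicator) auto
  also have "\<dots> \<le> (\<integral>\<^sup>+z. (\<integral>\<^sup>+w. ennreal \<bar>g z - g w\<bar> \<partial>density ?LL (indicator ?R)) \<partial>density ?LL (indicator ?R))"
    using mean_oscillation_le[OF DD.finite_measure_axioms intD] e1 e2 unfolding mR mD m_def by simp
  also have "\<dots> \<le> emeasure ?D2 (space ?D2) * (\<integral>\<^sup>+x2. \<integral>\<^sup>+x1. \<integral>\<^sup>+y1. ennreal \<bar>g (x1, x2) - g (y1, x2)\<bar> \<partial>?D1 \<partial>?D1 \<partial>?D2)
    + emeasure ?D1 (space ?D1) * (\<integral>\<^sup>+y1. \<integral>\<^sup>+y2. \<integral>\<^sup>+x2. ennreal \<bar>g (y1, x2) - g (y1, y2)\<bar> \<partial>?D2 \<partial>?D2 \<partial>?D1)"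
    unfolding DD[symmetric]
    by (intro pair_oscillation_le D1.sigma_finite_measure_axioms D2.sigma_finite_measure_axioms)
      (simp cong: measurable_cong_sets sets_pair_measure_cong)
  also have "emeasure ?D2 (space ?D2) = ennreal v2" using e2 by (simp add: emeasure_space_density_indicator[OF I2])
  also have "emeasure ?D1 (space ?D1) = ennreal v1" using e1 by (simp add: emeasure_space_density_indicator[OF I1])
  also have "(\<integral>\<^sup>+x2. \<integral>\<^sup>+x1. \<integral>\<^sup>+y1. ennreal \<bar>g (x1, x2) - g (y1, x2)\<bar> \<partial>?D1 \<partial>?D1 \<partial>?D2)
    = (\<integral>\<^sup>+x2. \<integral>\<^sup>+x1. (\<integral>\<^sup>+y1\<in>I1. ennreal \<bar>g (x1, x2) - g (y1, x2)\<bar> \<partial>L n1) \<partial>?D1 \<partial>?D2)"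
    by (intro nn_integral_cong nn_integral_density_indicator) auto
  also have "\<dots> = (\<integral>\<^sup>+x2. (\<integral>\<^sup>+x1\<in>I1. (\<integral>\<^sup>+y1\<in>I1. ennreal \<bar>g (x1, x2) - g (y1, x2)\<bar> \<partial>L n1) \<partial>L n1) \<partial>?D2)"
    by (intro nn_integral_cong nn_integral_density_indicator) auto
  also have "\<dots> = (\<integral>\<^sup>+x2\<in>I2. (\<integral>\<^sup>+x1\<in>I1. (\<integral>\<^sup>+y1\<in>I1. ennreal \<bar>g (x1, x2) - g (y1, x2)\<bar> \<partial>L n1) \<partial>L n1) \<partial>L n2)"
    by (intro nn_integral_density_indicator) auto
  also have "(\<integral>\<^sup>+y1. \<integral>\<^sup>+y2. \<integral>\<^sup>+x2. ennreal \<bar>g (y1, x2) - g (y1, y2)\<bar> \<partial>?D2 \<partial>?D2 \<partial>?D1)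
    = (\<integral>\<^sup>+y1. \<integral>\<^sup>+y2. (\<integral>\<^sup>+x2\<in>I2. ennreal \<bar>g (y1, x2) - g (y1, y2)\<bar> \<partial>L n2) \<partial>?D2 \<partial>?D1)"
    by (intro nn_integral_cong nn_integral_density_indicator) auto
  also have "\<dots> = (\<integral>\<^sup>+y1. (\<integral>\<^sup>+y2\<in>I2. (\<integral>\<^sup>+x2\<in>I2. ennreal \<bar>g (y1, x2) - g (y1, y2)\<bar> \<partial>L n2) \<partial>L n2) \<partial>?D1)"
    by (intro nn_integral_cong nn_integral_density_indicator) auto
  also have "\<dots> = (\<integral>\<^sup>+y1\<in>I1. (\<integral>\<^sup>+y2\<in>I2. (\<integral>\<^sup>+x2\<in>I2. ennreal \<bar>g (y1, x2) - g (y1, y2)\<bar> \<partial>L n2) \<partial>L n2) \<partial>L n1)"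
    by (intro nn_integral_density_indicator) auto
  finally show ?thesis .
qed

section \<open>From Lebesgue measurable functions to Borel representatives, and the
  conclusion\<close>

text \<open>Coordinates from \<open>n\<close> on are frozen at \<open>undefined\<close>, so the box
  is a full product of compact intervals and singletons, and Tychonoff's theorem applies.\<close>

lemma compact_box_extensional:
  fixes a b :: "nat \<Rightarrow> real"
  shows "compact (PiE {..<n} (\<lambda>i. {a i .. b i}))"
proof -
  have *: "PiE {..<n} (\<lambda>i. {a i .. b i}) = PiE UNIV (\<lambda>i. if i < n then {a i .. b i} else {undefined})"
    by (auto simp: PiE_def Pi_def extensional_def split: if_splits)
  have "compactin (product_topology (\<lambda>_. euclidean) UNIV)
      (PiE UNIV (\<lambda>i. if i < n then {a i .. b i} else {undefined}))"
    by (auto simp: compactin_PiE)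
  then show ?thesis
    unfolding * by (simp add: euclidean_product_topology)
qed

text \<open>Lets a Borel representative replace \<open>f\<close> in the seminorms. The exceptional
  set is null on almost every slice, so the replacement is made first in the inner variable and then
  in the middle one.\<close>

lemma fractional_integral_cong_AE:
  fixes \<phi> :: "real \<Rightarrow> real \<Rightarrow> 'a \<Rightarrow> 'a \<Rightarrow> ennreal"
  assumes "AE y in M. AE x in L. x \<in> A \<longrightarrow> y \<in> B \<longrightarrow> F x y = G x y"
  shows "(\<integral>\<^sup>+y\<in>B. (\<integral>\<^sup>+x\<in>A. (\<integral>\<^sup>+x'\<in>A. \<phi> (F x y) (F x' y) x x' \<partial>L) \<partial>L) \<partial>M)
    = (\<integral>\<^sup>+y\<in>B. (\<integral>\<^sup>+x\<in>A. (\<integral>\<^sup>+x'\<in>A. \<phi> (G x y) (G x' y) x x' \<partial>L) \<partial>L) \<partial>M)"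
proof (rule nn_integral_cong_AE)
  show "AE y in M. (\<integral>\<^sup>+x\<in>A. (\<integral>\<^sup>+x'\<in>A. \<phi> (F x y) (F x' y) x x' \<partial>L) \<partial>L) * indicator B y
    = (\<integral>\<^sup>+x\<in>A. (\<integral>\<^sup>+x'\<in>A. \<phi> (G x y) (G x' y) x x' \<partial>L) \<partial>L) * indicator B y"
    using assms
  proof eventually_elim
    case (elim y)
    show ?case
    proof (cases "y \<in> B")
      case True
      then have ae: "AE x in L. x \<in> A \<longrightarrow> F x y = G x y" using elim by simp
      have "(\<integral>\<^sup>+x\<in>A. (\<integral>\<^sup>+x'\<in>A. \<phi> (F x y) (F x' y) x x' \<partial>L) \<partial>L)
          = (\<integral>\<^sup>+x\<in>A. (\<integral>\<^sup>+x'\<in>A. \<phi> (F x y) (G x' y) x x' \<partial>L) \<partial>L)"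
        using ae by (intro nn_integral_cong arg_cong2[where f="(*)"] refl nn_integral_cong_AE)
          (auto split: split_indicator)
      also have "\<dots> = (\<integral>\<^sup>+x\<in>A. (\<integral>\<^sup>+x'\<in>A. \<phi> (G x y) (G x' y) x x' \<partial>L) \<partial>L)"
        using ae by (intro nn_integral_cong_AE) (auto split: split_indicator)
      finally show ?thesis by simp
    qed simp
  qed
qed

theorem theorem2p18:
  "\<exists>c :: nat \<Rightarrow> real. (\<forall>n. 0 < c n) \<and>
     (\<forall>n1 \<ge> 1. \<forall>n2 \<ge> 1. \<forall>p1 \<ge> 1. \<forall>p2 \<ge> 1. \<forall>\<delta>1 \<in> {0<..<1}. \<forall>\<delta>2 \<in> {0<..<1}.
      \<forall>f. locally_integrable n1 n2 f \<longrightarrow>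
        (\<forall>I1 I2 l1 l2. is_cube n1 l1 I1 \<and> is_cube n2 l2 I2 \<longrightarrow>
          ennreal (mean n1 n2 (I1 \<times> I2) (\<lambda>x. \<bar>f x - mean n1 n2 (I1 \<times> I2) f\<bar>))
          \<le> ennreal (c n1 * (1 - \<delta>1) powr (1 / p1)) * a1 n1 n2 p1 \<delta>1 f l1 I1 I2
            + ennreal (c n2 * (1 - \<delta>2) powr (1 / p2)) * a2 n1 n2 p2 \<delta>2 f l2 I1 I2))"
proof (intro exI[of _ poincare_const] conjI allI ballI impI poincare_const_pos)
  fix n1 n2 :: nat and p1 p2 \<delta>1 \<delta>2 l1 l2 :: real and f I1 I2
  assume n: "1 \<le> n1" "1 \<le> n2" and p: "1 \<le> p1" "1 \<le> p2"
    and \<delta>: "\<delta>1 \<in> {0<..<1}" "\<delta>2 \<in> {0<..<1}" and f: "locally_integrable n1 n2 f"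
    and cubes: "is_cube n1 l1 I1 \<and> is_cube n2 l2 I2"
  obtain b1 b2 where l: "0 < l1" "0 < l2"
    and I1: "I1 = PiE {..<n1} (\<lambda>i. {b1 i .. b1 i + l1})"
    and I2: "I2 = PiE {..<n2} (\<lambda>i. {b2 i .. b2 i + l2})"
    using cubes unfolding is_cube_def by blast
  let ?L1 = "leb_borel n1" and ?L2 = "leb_borel n2"
  let ?LL = "?L1 \<Otimes>\<^sub>M ?L2" and ?R = "I1 \<times> I2"
  have [measurable]: "I1 \<in> sets ?L1" "I2 \<in> sets ?L2" unfolding I1 I2 by measurable
  define v1 v2 where "v1 = l1 ^ n1" and "v2 = l2 ^ n2"
  have v: "0 < v1" "0 < v2" unfolding v1_def v2_def using l by auto
  have e1: "emeasure ?L1 I1 = ennreal v1" and e2: "emeasure ?L2 I2 = ennreal v2"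
    unfolding I1 I2 v1_def v2_def using l by (auto intro!: emeasure_cube)
  interpret L1: sigma_finite_measure ?L1 by (rule sigma_finite_leb_borel)
  interpret L2: sigma_finite_measure ?L2 by (rule sigma_finite_leb_borel)
  interpret P: pair_sigma_finite ?L1 ?L2 ..
  have R[measurable]: "?R \<in> sets ?LL" by measurable
  have eR: "emeasure ?LL ?R = ennreal (v1 * v2)"
    using e1 e2 v by (simp add: L2.emeasure_pair_measure_Times ennreal_mult)
  have eR': "emeasure (leb2 n1 n2) ?R = ennreal (v1 * v2)"
    unfolding leb2_def using eR by simp
  have mR: "measure (leb2 n1 n2) ?R = v1 * v2"
    unfolding measure_def eR' using v by simp

  have "compact ?R"
    unfolding I1 I2 by (intro compact_Times compact_box_extensional)
  moreover have "?R \<subseteq> space (leb2 n1 n2)"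
    unfolding leb2_def space_completion using R by (rule sets.sets_into_space)
  ultimately have intf: "integrable (leb2 n1 n2) (\<lambda>z. indicator ?R z * f z)"
    using f unfolding locally_integrable_def set_integrable_def by simp
  then have "(\<lambda>z. indicator ?R z * f z) \<in> borel_measurable (completion ?LL)"
    unfolding leb2_def by (rule borel_measurable_integrable)
  \<comment> \<open>\<open>g\<close> is a Borel representative of \<open>f\<close> cut off to the
    rectangle; every application of Tonelli's theorem concerns \<open>g\<close>.\<close>
  from completion_ex_borel_measurable_real[OF this]
  obtain g where g[measurable]: "g \<in> borel_measurable ?LL"
    and fg: "AE z in ?LL. indicator ?R z * f z = g z"
    by (elim bexE)
  have g2: "g \<in> borel_measurable (leb2 n1 n2)"
    unfolding leb2_def by (intro measurable_completion g)
  have fg2: "AE z in leb2 n1 n2. indicator ?R z * f z = g z"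
    unfolding leb2_def using fg by (rule AE_completion)
  have intg: "integrable ?LL g"
  proof -
    have "integrable (leb2 n1 n2) g"
      using intf g2 fg2 by (rule integrable_cong_AE_imp)
    then show ?thesis unfolding leb2_def by (simp only: integrable_completion[OF g])
  qed
  have intgR: "set_integrable ?LL ?R g"
    unfolding set_integrable_def by (rule integrable_mult_indicator[OF R intg])
  define m where "m = mean n1 n2 ?R f"
  have m: "m = 1 / (v1 * v2) * (LINT z:?R|?LL. g z)"
  proof -
    have "(LINT z:?R|leb2 n1 n2. f z) = (LINT z|leb2 n1 n2. indicator ?R z * g z)"
      unfolding set_lebesgue_integral_def real_scaleR_def
    proof (rule integral_cong_AE)
      show "AE z in leb2 n1 n2. indicator ?R z * f z = indicator ?R z * g z"
        using fg2 by eventually_elim (auto split: split_indicator_asm split_indicator)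
      show "(\<lambda>z. indicator ?R z * f z) \<in> borel_measurable (leb2 n1 n2)" using intf by simp
      show "(\<lambda>z. indicator ?R z * g z) \<in> borel_measurable (leb2 n1 n2)"
        unfolding leb2_def by (intro measurable_completion) measurable
    qed
    also have "\<dots> = (LINT z|?LL. indicator ?R z * g z)"
      unfolding leb2_def by (intro integral_completion) measurable
    finally show ?thesis
      unfolding m_def mean_def mR set_lebesgue_integral_def by simp
  qed

  have "ennreal (mean n1 n2 ?R (\<lambda>x. \<bar>f x - m\<bar>))
      = ennreal (1 / (v1 * v2)) * ennreal (norm (LINT z:?R|leb2 n1 n2. \<bar>f z - m\<bar>))"
    unfolding mean_def mR using v
    by (subst ennreal_mult[symmetric]) (auto simp: set_lebesgue_integral_def intro!: arg_cong[where f=ennreal])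
  \<comment> \<open>Without integrability the Bochner integral would be 0 by convention, and the
    inequality trivial.\<close>
  also have "ennreal (norm (LINT z:?R|leb2 n1 n2. \<bar>f z - m\<bar>))
      \<le> (\<integral>\<^sup>+z. ennreal (norm (indicator ?R z *\<^sub>R \<bar>f z - m\<bar>)) \<partial>leb2 n1 n2)"
    unfolding set_lebesgue_integral_def
  proof (cases "integrable (leb2 n1 n2) (\<lambda>z. indicator ?R z *\<^sub>R \<bar>f z - m\<bar>)")
    case True
    then show "ennreal (norm (LINT z|leb2 n1 n2. indicator ?R z *\<^sub>R \<bar>f z - m\<bar>))
      \<le> (\<integral>\<^sup>+z. ennreal (norm (indicator ?R z *\<^sub>R \<bar>f z - m\<bar>)) \<partial>leb2 n1 n2)"
      by (rule integral_norm_bound_ennreal)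
  qed (simp add: not_integrable_integral_eq)
  also have "\<dots> = (\<integral>\<^sup>+z. ennreal (norm (indicator ?R z *\<^sub>R \<bar>f z - m\<bar>)) \<partial>?LL)"
    unfolding leb2_def by (rule nn_integral_completion)
  also have "\<dots> = (\<integral>\<^sup>+z\<in>?R. ennreal \<bar>g z - m\<bar> \<partial>?LL)"
    using fg by (intro nn_integral_cong_AE, eventually_elim) (auto split: split_indicator_asm split_indicator)
  finally have mean_le: "ennreal (mean n1 n2 ?R (\<lambda>x. \<bar>f x - m\<bar>))
      \<le> ennreal (1 / (v1 * v2)) * (\<integral>\<^sup>+z\<in>?R. ennreal \<bar>g z - m\<bar> \<partial>?LL)"
    by (simp add: mult_left_mono)

  have ae1: "AE x2 in ?L2. AE x1 in ?L1. x1 \<in> I1 \<longrightarrow> x2 \<in> I2 \<longrightarrow> f (x1, x2) = g (x1, x2)"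
    and ae2: "AE x1 in ?L1. AE x2 in ?L2. x2 \<in> I2 \<longrightarrow> x1 \<in> I1 \<longrightarrow> f (x1, x2) = g (x1, x2)"
  proof -
    \<comment> \<open>The exceptional set of \<open>f\<close> is enclosed in a Borel null set,
      because exchanging the two almost-everywhere quantifiers requires a measurable set.\<close>
    obtain Z where Z: "Z \<in> null_sets ?LL" "{z \<in> space ?LL. indicator ?R z * f z \<noteq> g z} \<subseteq> Z"
      using fg by (auto elim!: AE_E2 AE_E simp: null_sets_def)
    have [measurable]: "Z \<in> sets ?LL" using Z(1) by auto
    have "AE z in ?LL. z \<notin> Z" using Z(1) by (rule AE_not_in)
    then have xy: "AE x in ?L1. AE y in ?L2. (x, y) \<notin> Z"
      by (rule P.AE_pair)
    moreover have "{z \<in> space ?LL. (fst z, snd z) \<notin> Z} \<in> sets ?LL" by measurable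
    ultimately have yx: "AE y in ?L2. AE x in ?L1. (x, y) \<notin> Z"
      using P.AE_commute[of "\<lambda>x y. (x, y) \<notin> Z"] by simp
    have sp: "x \<in> space ?L1 \<Longrightarrow> y \<in> space ?L2 \<Longrightarrow> (x, y) \<notin> Z \<Longrightarrow> x \<in> I1 \<Longrightarrow> y \<in> I2 \<Longrightarrow> f (x, y) = g (x, y)" for x y
      using Z(2) by (auto simp: space_pair_measure)
    show "AE x2 in ?L2. AE x1 in ?L1. x1 \<in> I1 \<longrightarrow> x2 \<in> I2 \<longrightarrow> f (x1, x2) = g (x1, x2)"
      using yx AE_space
    proof eventually_elim
      case (elim y)
      from elim(1) AE_space show ?case by eventually_elim (use elim(2) sp in blast)
    qed
    show "AE x1 in ?L1. AE x2 in ?L2. x2 \<in> I2 \<longrightarrow> x1 \<in> I1 \<longrightarrow> f (x1, x2) = g (x1, x2)"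
      using xy AE_space
    proof eventually_elim
      case (elim x)
      from elim(1) AE_space show ?case by eventually_elim (use elim(2) sp in blast)
    qed
  qed

  define T1 where "T1 = ennreal (poincare_const n1 * (1 - \<delta>1) powr (1 / p1)) * a1 n1 n2 p1 \<delta>1 f l1 I1 I2"
  define T2 where "T2 = ennreal (poincare_const n2 * (1 - \<delta>2) powr (1 / p2)) * a2 n1 n2 p2 \<delta>2 f l2 I1 I2"
  \<comment> \<open>Nonnegative integrals do not change under completion, whatever the integrand, so
    \<open>leb\<close> becomes \<open>leb_borel\<close> before \<open>f\<close> is replaced by
    \<open>g\<close>.\<close>
  have a1: "a1 n1 n2 p1 \<delta>1 f l1 I1 I2 = ennreal (l1 powr \<delta>1) * ennreal_powr ((\<integral>\<^sup>+y\<in>I2. (\<integral>\<^sup>+x\<in>I1. (\<integral>\<^sup>+x'\<in>I1.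
          ennreal (\<bar>g (x, y) - g (x', y)\<bar> powr p1 / euclidean_dist n1 x x' powr (real n1 + p1 * \<delta>1))
          \<partial>?L1) \<partial>?L1) \<partial>?L2) / ennreal (l1 ^ n1 * v2)) (1 / p1)"
    unfolding a1_def leb_def nn_integral_completion eR' v1_def[symmetric]
    by (subst fractional_integral_cong_AE[OF ae1, where \<phi>="\<lambda>s t x x'. ennreal (\<bar>s - t\<bar> powr p1 /
      euclidean_dist n1 x x' powr (real n1 + p1 * \<delta>1))"]) (rule refl)
  have a2: "a2 n1 n2 p2 \<delta>2 f l2 I1 I2 = ennreal (l2 powr \<delta>2) * ennreal_powr ((\<integral>\<^sup>+y\<in>I1. (\<integral>\<^sup>+x\<in>I2. (\<integral>\<^sup>+x'\<in>I2.
          ennreal (\<bar>g (y, x) - g (y, x')\<bar> powr p2 / euclidean_dist n2 x x' powr (real n2 + p2 * \<delta>2))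
          \<partial>?L2) \<partial>?L2) \<partial>?L1) / ennreal (l2 ^ n2 * v1)) (1 / p2)"
  proof -
    \<comment> \<open>In \<open>a2\<close> the inner variable is the first argument of the kernel.
      By symmetry the outer one is put first, as in \<open>fractional_term_bound\<close>.\<close>
    have "(\<integral>\<^sup>+y\<in>I1. (\<integral>\<^sup>+x\<in>I2. (\<integral>\<^sup>+x'\<in>I2. ennreal (\<bar>f (y, x') - f (y, x)\<bar> powr p2 /
          euclidean_dist n2 x' x powr (real n2 + p2 * \<delta>2)) \<partial>?L2) \<partial>?L2) \<partial>?L1)
      = (\<integral>\<^sup>+y\<in>I1. (\<integral>\<^sup>+x\<in>I2. (\<integral>\<^sup>+x'\<in>I2. ennreal (\<bar>f (y, x) - f (y, x')\<bar> powr p2 /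
          euclidean_dist n2 x x' powr (real n2 + p2 * \<delta>2)) \<partial>?L2) \<partial>?L2) \<partial>?L1)"
      (is "_ = ?F")
    proof (intro nn_integral_cong arg_cong2[where f="(*)"] refl)
      fix x x' y
      show "ennreal (\<bar>f (y, x') - f (y, x)\<bar> powr p2 / euclidean_dist n2 x' x powr (real n2 + p2 * \<delta>2))
        = ennreal (\<bar>f (y, x) - f (y, x')\<bar> powr p2 / euclidean_dist n2 x x' powr (real n2 + p2 * \<delta>2))"
        by (subst euclidean_dist_commute) (simp only: abs_minus_commute)
    qed
    also have "?F = (\<integral>\<^sup>+y\<in>I1. (\<integral>\<^sup>+x\<in>I2. (\<integral>\<^sup>+x'\<in>I2. ennreal (\<bar>g (y, x) - g (y, x')\<bar> powr p2 /
          euclidean_dist n2 x x' powr (real n2 + p2 * \<delta>2)) \<partial>?L2) \<partial>?L2) \<partial>?L1)"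
      by (rule fractional_integral_cong_AE[OF ae2, where \<phi>="\<lambda>s t x x'. ennreal (\<bar>s - t\<bar> powr p2 /
        euclidean_dist n2 x x' powr (real n2 + p2 * \<delta>2))"])
    finally show ?thesis
      unfolding a2_def leb_def nn_integral_completion eR' v2_def[symmetric] mult.commute[of v2 v1]
      by (simp only:)
  qed
  have H1: "(\<integral>\<^sup>+x2\<in>I2. (\<integral>\<^sup>+x1\<in>I1. (\<integral>\<^sup>+y1\<in>I1. ennreal \<bar>g (x1, x2) - g (y1, x2)\<bar> \<partial>?L1) \<partial>?L1) \<partial>?L2)
      \<le> ennreal (v1 * v1 * v2) * T1"
    unfolding T1_def a1 v1_def using \<delta> n p l e2 v
    by (intro fractional_term_bound[where a=b1] g I1) auto
  have gs: "(\<lambda>z. g (snd z, fst z)) \<in> borel_measurable (?L2 \<Otimes>\<^sub>M ?L1)"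
    by measurable
  have H2: "(\<integral>\<^sup>+y1\<in>I1. (\<integral>\<^sup>+y2\<in>I2. (\<integral>\<^sup>+x2\<in>I2. ennreal \<bar>g (y1, x2) - g (y1, y2)\<bar> \<partial>?L2) \<partial>?L2) \<partial>?L1)
      \<le> ennreal (v2 * v2 * v1) * T2"
    unfolding T2_def a2 v2_def abs_minus_commute[of "g (_, _)" "g (_, _)"] using \<delta> n p l e1 v
      fractional_term_bound[OF gs _ e1 v(1) I2 l(2) n(2) p(2), of \<delta>2]
    by (simp add: abs_minus_commute)
  have "ennreal (v1 * v2) * (\<integral>\<^sup>+z\<in>?R. ennreal \<bar>g z - m\<bar> \<partial>?LL)
      \<le> ennreal v2 * (ennreal (v1 * v1 * v2) * T1) + ennreal v1 * (ennreal (v2 * v2 * v1) * T2)"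
    using rectangle_oscillation_le[OF g _ e1 v(1) _ e2 v(2) intgR] unfolding m[symmetric]
    by (rule order_trans) (auto intro!: add_mono mult_left_mono H1 H2)
  \<comment> \<open>Each term carries the mass of two copies of one cube and one of the other; the
    extra factor from the splitting completes both to the squared volume of the rectangle.\<close>
  also have "\<dots> = ennreal (v1 * v2) * ennreal (v1 * v2) * (T1 + T2)"
  proof -
    have "ennreal v2 * ennreal (v1 * v1 * v2) = ennreal (v1 * v2) * ennreal (v1 * v2)"
      "ennreal v1 * ennreal (v2 * v2 * v1) = ennreal (v1 * v2) * ennreal (v1 * v2)"
      using v by (simp_all add: ennreal_mult[symmetric] mult_ac)
    then show ?thesis by (simp only: mult.assoc[symmetric] distrib_left)
  qed
  finally have main: "ennreal (v1 * v2) * (\<integral>\<^sup>+z\<in>?R. ennreal \<bar>g z - m\<bar> \<partial>?LL)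
      \<le> ennreal (v1 * v2) * ennreal (v1 * v2) * (T1 + T2)" .
  have inv: "ennreal (1 / (v1 * v2)) * ennreal (v1 * v2) = 1"
    using v by (simp add: ennreal_mult[symmetric])
  have "ennreal (1 / (v1 * v2)) * (\<integral>\<^sup>+z\<in>?R. ennreal \<bar>g z - m\<bar> \<partial>?LL) \<le> T1 + T2"
  proof -
    \<comment> \<open>\<open>T1 + T2\<close> may be infinite, so the volume is cancelled by
      multiplying with its finite reciprocal.\<close>
    let ?w = "ennreal (1 / (v1 * v2))" and ?V = "ennreal (v1 * v2)" and ?X = "\<integral>\<^sup>+z\<in>?R. ennreal \<bar>g z - m\<bar> \<partial>?LL"
    have "?w * ?X = ?w * (?w * ?V) * ?X" by (simp add: inv)
    also have "\<dots> = ?w * ?w * (?V * ?X)" by (simp only: mult_ac)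
    also have "\<dots> \<le> ?w * ?w * (?V * ?V * (T1 + T2))" by (intro mult_left_mono main) simp
    also have "\<dots> = (?w * ?V) * (?w * ?V) * (T1 + T2)" by (simp only: mult_ac)
    also have "\<dots> = T1 + T2" by (simp add: inv)
    finally show ?thesis .
  qed
  with mean_le have "ennreal (mean n1 n2 ?R (\<lambda>x. \<bar>f x - m\<bar>)) \<le> T1 + T2"
    by (rule order_trans)
  then show "ennreal (mean n1 n2 (I1 \<times> I2) (\<lambda>x. \<bar>f x - mean n1 n2 (I1 \<times> I2) f\<bar>))
          \<le> ennreal (poincare_const n1 * (1 - \<delta>1) powr (1 / p1)) * a1 n1 n2 p1 \<delta>1 f l1 I1 I2
            + ennreal (poincare_const n2 * (1 - \<delta>2) powr (1 / p2)) * a2 n1 n2 p2 \<delta>2 f l2 I1 I2"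
    unfolding m_def T1_def T2_def .
qed

end
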